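(* Let $\mathcal V=\mathbb R^{2N}(u_1,v_1,\dots,u_N,v_N)$ and $$U=\sum_{k=1}^N u_kE_{kk}+\lambda\sum_{k=1}^N E_{k+1,k},\qquad V=I+\lambda^{-1}\sum_{k=1}^N v_kE_{k,k+1},\qquad \mathcal F=I-h\lambda\sum_{k=1}^NE_{k+1,k}.$$ The hierarchy associated with the Lax matrix $L_+=\mathcal F^{-1}UV$ is described by the Lax triads $$\dot U=\mathcal A_1U-U\mathcal A_2,\qquad \dot V=\mathcal A_2V-V\mathcal A_0,$$ supplemented by the identity $$\dot{\mathcal F}=0=\mathcal A_1\mathcal F-\mathcal F\mathcal A_0,$$ so that $L_+$ satisfies the Lax equation $\dot L_+=[\mathcal A_0,L_+]$. Here $$\mathcal A_0=\pi_-(f(L_+))-\sigma(f(L_+)),$$ and the matrices $\mathcal A_1,\mathcal A_2$ are uniquely defined by the condition of compatibility of these equations. In particular, the "first" flow of the hierarchy, corresponding to $f(L)=L$, coincides with $$\dot u_k=u_k(v_k-v_{k-1}+hu_kv_k-hu_{k-1}v_{k-1}),\qquad \dot v_k=v_k(u_{k+1}-u_k+hu_{k+1}v_{k+1}-hu_kv_k),$$ and for this flow $$\mathcal A_0=\lambda^{-1}\sum_{k=1}^Nu_kv_kE_{k,k+1}-h\sum_{k=1}^Nu_kv_kE_{kk},$$ $$\mathcal A_1=\lambda^{-1}\sum_{k=1}^Nu_kv_kE_{k,k+1}-h\sum_{k=1}^Nu_{k-1}v_{k-1}E_{kk},$$ $$\mathcal A_2=\lambda^{-1}\sum_{k=1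}^Nu_{k+1}v_kE_{k,k+1}-h\sum_{k=1}^Nu_kv_kE_{kk}.$$
   Context: All subscripts are taken mod $N$ (periodic boundary conditions); $h$ is a (small) real parameter. $E_{jk}$ is the $N\times N$ matrix unit, $E_{N+1,N}=E_{1,N}$, $E_{N,N+1}=E_{N,1}$. With $\mathcal E=\lambda\sum_kE_{k+1,k}$ and $\mathcal E^{-1}=\lambda^{-1}\sum_kE_{k,k+1}$, $\mathfrak g$ is the twisted loop algebra of elements $\sum_p\ell^{(p)}\mathcal E^p$ with $\ell^{(p)}$ diagonal $\lambda$-independent $N\times N$ matrices (Laurent polynomials in $\lambda$; $\mathcal F^{-1}=\sum_{n\ge0}h^n\mathcal E^n$ is understood as a series in positive powers of $\lambda$). $\pi_-(\sum_p\ell^{(p)}\mathcal E^p)=\sum_{p<0}\ell^{(p)}\mathcal E^p$, and $\sigma$ is the linear map into diagonal matrices $\sigma(\sum_p\ell^{(p)}\mathcal E^p)=\sum_{p<0}h^{-p}\ell^{(p)}$. $f$ is a conjugation covariant function on $\mathfrak g$ (e.g. a polynomial), one flow of the hierarchy for each $f$. "Compatibility" means that the matrix equations consistently define an evolution of the coordinates $(u,v)$: $\mathcal A_1\mathcal F=\mathcal F\mathcal A_0$, the expression $\mathcal A_1U-U\mathcal A_2$ is a $\lambda$-independent diagonal matrix (which is then $\dot U={\rm diag}(\dot u_k)$), and $\mathcal A_2V-V\mathcal A_0$ is of the form $\lambda^{-1}\sum_k c_kE_{k,k+1}$ (which is then $\dot V$, $\dot v_k=c_k$).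
   Formalization: Uniqueness of A_2 fails at points where some u_k and some v_j vanish (e.g. u=v=0, f(L)=L); it is proved where all u_k or all v_k are nonzero, and on all of V for A_1, A_2 continuous in (u,v), such continuous matrices being shown to exist for continuous f. *)

theory Defs
  imports
    "Jordan_Normal_Form.Matrix"
    "HOL-Computational_Algebra.Formal_Laurent_Series"
    "HOL-Analysis.Function_Topology"
begin

text \<open>
  Indices run over \<open>{0..<N}\<close>, i.e. the residue classes modulo \<open>N\<close>; the paper's index \<open>N\<close> is \<open>0\<close>.
  A point of the phase space is given by \<open>u v :: nat \<Rightarrow> real\<close>, of which only the values below \<open>N\<close>
  are used. The loop parameter is \<open>fls_X\<close>.
\<close>

definition munit :: "nat \<Rightarrow> nat \<Rightarrow> nat \<Rightarrow> real fls mat" where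
  "munit N j k = mat N N (\<lambda>(a, b). if a = j mod N \<and> b = k mod N then 1 else 0)"

definition msum :: "nat \<Rightarrow> (nat \<Rightarrow> real fls mat) \<Rightarrow> real fls mat" where
  "msum N M = mat N N (\<lambda>(i, j). \<Sum>k<N. M k $$ (i, j))"

definition Emat :: "nat \<Rightarrow> real fls mat" where
  "Emat N = fls_X \<cdot>\<^sub>m msum N (\<lambda>k. munit N (k + 1) k)"

definition Emat_inv :: "nat \<Rightarrow> real fls mat" where
  "Emat_inv N = fls_X_inv \<cdot>\<^sub>m msum N (\<lambda>k. munit N k (k + 1))"

definition Epow :: "nat \<Rightarrow> int \<Rightarrow> real fls mat" where
  "Epow N p = (if 0 \<le> p then Emat N ^\<^sub>m nat p else Emat_inv N ^\<^sub>m nat (- p))"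

text \<open>
  \<open>loop N l\<close> is the (possibly infinite in the positive direction) sum of \<open>diag(l p) * Epow N p\<close>
  over all integers \<open>p\<close>; see \<open>Epow_index\<close> and \<open>loop_eq_sum\<close> below.
\<close>

definition loop :: "nat \<Rightarrow> (int \<Rightarrow> nat \<Rightarrow> real) \<Rightarrow> real fls mat" where
  "loop N l = mat N N (\<lambda>(i, j).
     Abs_fls (\<lambda>p. if int i mod int N = (int j + p) mod int N then l p i else 0))"

lemma msum_up_index:
  assumes "i < N" "j < N"
  shows "msum N (\<lambda>k. munit N (k + 1) k) $$ (i, j) =
    (if int i mod int N = (int j + 1) mod int N then 1 else 0)"
proof -
  have "msum N (\<lambda>k. munit N (k + 1) k) $$ (i, j) = (\<Sum>k<N. munit N (k + 1) k $$ (i, j))"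
    using assms by (simp add: msum_def)
  also have "\<dots> = (\<Sum>k<N. if k = j then (if i = (j + 1) mod N then 1 else 0) else 0)"
    by (rule sum.cong) (use assms in \<open>auto simp: munit_def\<close>)
  also have "\<dots> = (if i = (j + 1) mod N then 1 else 0)"
    using assms by simp
  also have "i = (j + 1) mod N \<longleftrightarrow> int i mod int N = (int j + 1) mod int N"
    using assms
    by (metis mod_less of_nat_1 of_nat_add of_nat_eq_iff zmod_int)
  finally show ?thesis .
qed

lemma msum_down_index:
  assumes "i < N" "j < N"
  shows "msum N (\<lambda>k. munit N k (k + 1)) $$ (i, j) =
    (if int i mod int N = (int j - 1) mod int N then 1 else 0)"
proof -
  have "msum N (\<lambda>k. munit N k (k + 1)) $$ (i, j) = (\<Sum>k<N. munit N k (k + 1) $$ (i, j))"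
    using assms by (simp add: msum_def)
  also have "\<dots> = (\<Sum>k<N. if k = i then (if j = (i + 1) mod N then 1 else 0) else 0)"
    by (rule sum.cong) (use assms in \<open>auto simp: munit_def\<close>)
  also have "\<dots> = (if j = (i + 1) mod N then 1 else 0)"
    using assms by simp
  also have "j = (i + 1) mod N \<longleftrightarrow> int j mod int N = (int i + 1) mod int N"
    using assms
    by (metis mod_less of_nat_1 of_nat_add of_nat_eq_iff zmod_int)
  also have "\<dots> \<longleftrightarrow> int i mod int N = (int j - 1) mod int N"
    by (smt (verit) mod_eq_dvd_iff dvd_minus_iff)
  finally show ?thesis by simp
qed

lemma Emat_carrier [simp]: "Emat N \<in> carrier_mat N N"
  by (simp add: Emat_def msum_def)

lemma Emat_inv_carrier [simp]: "Emat_inv N \<in> carrier_mat N N"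
  by (simp add: Emat_inv_def msum_def)

lemma Epow_carrier [simp]: "Epow N p \<in> carrier_mat N N"
  by (simp add: Epow_def pow_carrier_mat)

lemma pow_shift_index:
  assumes A: "A \<in> carrier_mat N N"
    and ent: "\<And>i j. i < N \<Longrightarrow> j < N \<Longrightarrow>
      A $$ (i, j) = (if int i mod int N = (int j + s) mod int N then x else (0 :: real fls))"
    and "i < N" "j < N"
  shows "(A ^\<^sub>m n) $$ (i, j) =
    (if int i mod int N = (int j + s * int n) mod int N then x ^ n else 0)"
  using assms(3,4)
proof (induction n arbitrary: i j)
  case 0
  then show ?case using A by auto
next
  case (Suc n)
  define m where "m = nat ((int j + s) mod int N)"
  have N: "N > 0" using Suc.prems by simp
  have m: "m < N" "int m = (int j + s) mod int N"
    using N by (auto simp: m_def nat_less_iff)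
  have An: "A ^\<^sub>m n \<in> carrier_mat N N" using A by (rule pow_carrier_mat)
  have "(A ^\<^sub>m Suc n) $$ (i, j) = (\<Sum>k<N. (A ^\<^sub>m n) $$ (i, k) * A $$ (k, j))"
    using A An Suc.prems by (simp add: scalar_prod_def lessThan_atLeast0)
  also have "\<dots> = (\<Sum>k<N. if k = m then (A ^\<^sub>m n) $$ (i, m) * x else 0)"
  proof (rule sum.cong[OF refl])
    fix k assume k: "k \<in> {..<N}"
    have "int k mod int N = (int j + s) mod int N \<longleftrightarrow> k = m"
      using k m by auto
    then show "(A ^\<^sub>m n) $$ (i, k) * A $$ (k, j) = (if k = m then (A ^\<^sub>m n) $$ (i, m) * x else 0)"
      using k Suc.prems by (simp add: ent)
  qed
  also have "\<dots> = (A ^\<^sub>m n) $$ (i, m) * x"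
    using m by simp
  also have "(int m + s * int n) mod int N = (int j + s * int (Suc n)) mod int N"
    by (simp add: m mod_simps algebra_simps)
  then have "(A ^\<^sub>m n) $$ (i, m) * x =
      (if int i mod int N = (int j + s * int (Suc n)) mod int N then x ^ Suc n else 0)"
    using Suc.IH[OF Suc.prems(1) m(1)] by (simp add: mult.commute)
  finally show ?case .
qed

lemma Epow_index:
  assumes "i < N" "j < N"
  shows "Epow N p $$ (i, j) =
    (if int i mod int N = (int j + p) mod int N then fls_X_intpow p else 0)"
proof (cases "0 \<le> p")
  case True
  have "(Emat N ^\<^sub>m nat p) $$ (i, j) =
      (if int i mod int N = (int j + 1 * int (nat p)) mod int N then fls_X ^ nat p else 0)"
    by (rule pow_shift_index) (use assms msum_up_index in \<open>auto simp: Emat_def msum_def\<close>)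
  then show ?thesis using True by (simp add: Epow_def fls_X_power_conv_shift_1)
next
  case False
  have "(Emat_inv N ^\<^sub>m nat (- p)) $$ (i, j) =
      (if int i mod int N = (int j + (- 1) * int (nat (- p))) mod int N
       then fls_X_inv ^ nat (- p) else 0)"
    by (rule pow_shift_index) (use assms msum_down_index in \<open>auto simp: Emat_inv_def msum_def\<close>)
  then show ?thesis using False by (simp add: Epow_def fls_X_inv_power_conv_shift_1)
qed

lemma loop_nth:
  assumes "i < N" "j < N" and b: "\<And>p. p < b \<Longrightarrow> l p i = 0"
  shows "fls_nth (loop N l $$ (i, j)) p =
    (if int i mod int N = (int j + p) mod int N then l p i else 0)"
proof -
  have "fls_nth (Abs_fls (\<lambda>p. if int i mod int N = (int j + p) mod int N then l p i else 0)) p =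
      (if int i mod int N = (int j + p) mod int N then l p i else 0)"
    by (subst nth_Abs_fls_lower_bound[of b]) (use b in auto)
  then show ?thesis using assms by (simp add: loop_def)
qed

lemma loop_eq_sum:
  assumes "finite S" "\<And>p i. p \<notin> S \<Longrightarrow> i < N \<Longrightarrow> l p i = 0" and ij: "i < N" "j < N"
  shows "loop N l $$ (i, j) =
    (\<Sum>p\<in>S. (mat_diag N (\<lambda>k. fls_const (l p k)) * Epow N p) $$ (i, j))"
proof (rule fls_eqI)
  fix q
  have b: "l p i = 0" if "p < Min (insert 0 S)" for p
    using that assms(2)[of p i] assms(1) ij by (cases "p \<in> S") (auto simp: Min_gr_iff)
  have "fls_nth (\<Sum>p\<in>S. (mat_diag N (\<lambda>k. fls_const (l p k)) * Epow N p) $$ (i, j)) q =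
      (\<Sum>p\<in>S. if p = q then (if int i mod int N = (int j + q) mod int N then l q i else 0) else 0)"
    unfolding fls_nth_sum
    by (rule sum.cong[OF refl])
       (use ij in \<open>auto simp: mat_diag_mult_left[OF Epow_carrier] Epow_index\<close>)
  also have "\<dots> = fls_nth (loop N l $$ (i, j)) q"
    using loop_nth[OF ij, of "Min (insert 0 S)" l q] b assms(1,2) ij by (auto simp: sum.delta)
  finally show "fls_nth (loop N l $$ (i, j)) q =
    fls_nth (\<Sum>p\<in>S. (mat_diag N (\<lambda>k. fls_const (l p k)) * Epow N p) $$ (i, j)) q" by simp
qed

text \<open>The \<open>i\<close>-th diagonal entry of the coefficient of \<open>Epow N p\<close> in \<open>M\<close>.\<close>

definition lcoeff :: "nat \<Rightarrow> real fls mat \<Rightarrow> int \<Rightarrow> nat \<Rightarrow> real" where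
  "lcoeff N M p i = fls_nth (M $$ (i, nat ((int i - p) mod int N))) p"

text \<open>
  \<open>loop_algebra\<close> consists of the Laurent polynomials. \<open>loop_series\<close> is its completion in the
  direction of positive powers, which contains the inverse of \<open>Fmat\<close> and hence the Lax matrix.
\<close>

definition loop_algebra :: "nat \<Rightarrow> real fls mat set" where
  "loop_algebra N = {loop N l | l. finite {p. \<exists>i<N. l p i \<noteq> 0}}"

definition loop_series :: "nat \<Rightarrow> real fls mat set" where
  "loop_series N = {loop N l | l. \<exists>b. \<forall>p<b. \<forall>i<N. l p i = 0}"

definition pi_minus :: "nat \<Rightarrow> real fls mat \<Rightarrow> real fls mat" where
  "pi_minus N M = loop N (\<lambda>p i. if p < 0 then lcoeff N M p i else 0)"

text \<open>
  The sum in \<open>sigma\<close> is restricted to the nonzero terms, of which there are finitely many.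
\<close>

definition sigma :: "nat \<Rightarrow> real \<Rightarrow> real fls mat \<Rightarrow> real fls mat" where
  "sigma N h M = mat_diag N (\<lambda>i. fls_const
     (\<Sum>p | p < 0 \<and> lcoeff N M p i \<noteq> 0. h ^ nat (- p) * lcoeff N M p i))"

definition conj_covariant :: "nat \<Rightarrow> (real fls mat \<Rightarrow> real fls mat) \<Rightarrow> bool" where
  "conj_covariant N f \<longleftrightarrow> f ` loop_series N \<subseteq> loop_series N \<and>
     (\<forall>X\<in>loop_series N. \<forall>P\<in>loop_series N. \<forall>Q\<in>loop_series N.
        P * Q = 1\<^sub>m N \<and> Q * P = 1\<^sub>m N \<longrightarrow> f (P * X * Q) = P * f X * Q)"

text \<open>
  Convergence in the completed algebra: all coefficients converge and the sequence is uniformly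
  bounded from below in degree. Polynomials are continuous in this sense.
\<close>

definition loop_tendsto :: "nat \<Rightarrow> (nat \<Rightarrow> real fls mat) \<Rightarrow> real fls mat \<Rightarrow> bool" where
  "loop_tendsto N X Y \<longleftrightarrow>
     (\<exists>b. \<forall>n. \<forall>i<N. \<forall>j<N. \<forall>p<b. fls_nth (X n $$ (i, j)) p = 0) \<and>
     (\<forall>i<N. \<forall>j<N. \<forall>p. (\<lambda>n. fls_nth (X n $$ (i, j)) p) \<longlonglongrightarrow> fls_nth (Y $$ (i, j)) p)"

definition loop_continuous :: "nat \<Rightarrow> (real fls mat \<Rightarrow> real fls mat) \<Rightarrow> bool" where
  "loop_continuous N f \<longleftrightarrow>
     (\<forall>X Y. range X \<subseteq> loop_series N \<and> Y \<in> loop_series N \<and> loop_tendsto N X Y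
        \<longrightarrow> loop_tendsto N (\<lambda>n. f (X n)) (f Y))"

definition has_loop_derivative :: "nat \<Rightarrow> (real \<Rightarrow> real fls mat) \<Rightarrow> real fls mat \<Rightarrow> real \<Rightarrow> bool" where
  "has_loop_derivative N X D t \<longleftrightarrow> (\<forall>i<N. \<forall>j<N. \<forall>p.
     ((\<lambda>s. fls_nth (X s $$ (i, j)) p) has_real_derivative fls_nth (D $$ (i, j)) p) (at t))"

definition Umat :: "nat \<Rightarrow> (nat \<Rightarrow> real) \<Rightarrow> real fls mat" where
  "Umat N u = msum N (\<lambda>k. fls_const (u k) \<cdot>\<^sub>m munit N k k)
     + fls_X \<cdot>\<^sub>m msum N (\<lambda>k. munit N (k + 1) k)"

definition Vmat :: "nat \<Rightarrow> (nat \<Rightarrow> real) \<Rightarrow> real fls mat" where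
  "Vmat N v = 1\<^sub>m N + fls_X_inv \<cdot>\<^sub>m msum N (\<lambda>k. fls_const (v k) \<cdot>\<^sub>m munit N k (k + 1))"

definition Fmat :: "nat \<Rightarrow> real \<Rightarrow> real fls mat" where
  "Fmat N h = 1\<^sub>m N - (fls_const h * fls_X) \<cdot>\<^sub>m msum N (\<lambda>k. munit N (k + 1) k)"

text \<open>The series of the powers \<open>h ^ n\<close> times \<open>Epow N n\<close>, for \<open>n \<ge> 0\<close>.\<close>

definition Fmat_inv :: "nat \<Rightarrow> real \<Rightarrow> real fls mat" where
  "Fmat_inv N h = loop N (\<lambda>n i. if 0 \<le> n then h ^ nat n else 0)"

lemma Fmat_inv_mult:
  assumes "N > 0"
  shows "Fmat_inv N h * Fmat N h = 1\<^sub>m N"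
proof (rule eq_matI)
  fix i j assume "i < dim_row (1\<^sub>m N :: real fls mat)" "j < dim_col (1\<^sub>m N :: real fls mat)"
  then have ij: "i < N" "j < N" by auto
  define m where "m = nat ((int j + 1) mod int N)"
  have m: "m < N" "int m = (int j + 1) mod int N"
    using assms by (auto simp: m_def nat_less_iff)
  let ?G = "Fmat_inv N h" and ?P = "msum N (\<lambda>k. munit N (k + 1) k)"
  have P: "?P \<in> carrier_mat N N" by (simp add: msum_def)
  have G: "?G \<in> carrier_mat N N" by (simp add: Fmat_inv_def loop_def)
  have Gn: "fls_nth (?G $$ (i, k)) p =
      (if int i mod int N = (int k + p) mod int N \<and> 0 \<le> p then h ^ nat p else 0)" if "k < N" for k p
    unfolding Fmat_inv_def using loop_nth[of i N k 0 "\<lambda>n i. if 0 \<le> n then h ^ nat n else 0" p] that ij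
    by simp
  have "(?G * Fmat N h) $$ (i, j) =
      (\<Sum>k<N. ?G $$ (i, k) * (if k = j then 1 else 0)) -
      (\<Sum>k<N. ?G $$ (i, k) * (fls_const h * fls_X * ?P $$ (k, j)))"
  proof -
    have "(?G * Fmat N h) $$ (i, j) = (\<Sum>k<N. ?G $$ (i, k) * Fmat N h $$ (k, j))"
      using ij G P by (simp add: scalar_prod_def lessThan_atLeast0 Fmat_def)
    also have "\<dots> = (\<Sum>k<N. ?G $$ (i, k) * (if k = j then 1 else 0) -
        ?G $$ (i, k) * (fls_const h * fls_X * ?P $$ (k, j)))"
    proof (rule sum.cong[OF refl])
      fix k assume "k \<in> {..<N}"
      then have "Fmat N h $$ (k, j) = (if k = j then 1 else 0) - fls_const h * fls_X * ?P $$ (k, j)"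
        using ij P by (simp add: Fmat_def)
      then show "?G $$ (i, k) * Fmat N h $$ (k, j) = ?G $$ (i, k) * (if k = j then 1 else 0) -
          ?G $$ (i, k) * (fls_const h * fls_X * ?P $$ (k, j))"
        by (simp only: right_diff_distrib)
    qed
    finally show ?thesis by (simp only: sum_subtractf)
  qed
  also have "(\<Sum>k<N. ?G $$ (i, k) * (if k = j then 1 else 0)) = ?G $$ (i, j)"
    using ij by (simp add: sum.delta if_distrib cong: if_cong)
  also have "(\<Sum>k<N. ?G $$ (i, k) * (fls_const h * fls_X * ?P $$ (k, j))) =
      (\<Sum>k<N. if k = m then ?G $$ (i, m) * (fls_const h * fls_X) else 0)"
  proof (rule sum.cong[OF refl])
    fix k assume k: "k \<in> {..<N}"
    have "int k mod int N = (int j + 1) mod int N \<longleftrightarrow> k = m"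
      using k m by auto
    then show "?G $$ (i, k) * (fls_const h * fls_X * ?P $$ (k, j)) =
        (if k = m then ?G $$ (i, m) * (fls_const h * fls_X) else 0)"
      using k ij msum_up_index[of k N j] by simp
  qed
  also have "\<dots> = fls_const h * (fls_X * ?G $$ (i, m))"
    using m by (simp add: mult_ac)
  also have "?G $$ (i, j) - fls_const h * (fls_X * ?G $$ (i, m)) = (1\<^sub>m N :: real fls mat) $$ (i, j)"
  proof (rule fls_eqI)
    fix p :: int
    have e: "(int m + (p - 1)) mod int N = (int j + p) mod int N"
      unfolding m by (simp add: mod_simps)
    have h: "h ^ nat p = h * h ^ nat (p - 1)" if "p \<ge> 1"
      using that by (metis Suc_nat_eq_nat_zadd1 add.commute diff_add_cancel diff_ge_0_iff_ge power_Suc)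
    have "int i mod int N = int j mod int N \<longleftrightarrow> i = j" using ij by auto
    then show "fls_nth (?G $$ (i, j) - fls_const h * (fls_X * ?G $$ (i, m))) p =
        fls_nth ((1\<^sub>m N :: real fls mat) $$ (i, j)) p"
      using h e ij m by (cases "p \<ge> 1"; cases "p = 0") (auto simp: Gn fls_X_times_conv_shift)
  qed
  finally show "(?G * Fmat N h) $$ (i, j) = (1\<^sub>m N :: real fls mat) $$ (i, j)" .
qed (auto simp: Fmat_inv_def loop_def Fmat_def msum_def)

definition Lplus :: "nat \<Rightarrow> real \<Rightarrow> (nat \<Rightarrow> real) \<Rightarrow> (nat \<Rightarrow> real) \<Rightarrow> real fls mat" where
  "Lplus N h u v = Fmat_inv N h * Umat N u * Vmat N v"

definition A0 :: "nat \<Rightarrow> real \<Rightarrow> (real fls mat \<Rightarrow> real fls mat) \<Rightarrow>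
    (nat \<Rightarrow> real) \<Rightarrow> (nat \<Rightarrow> real) \<Rightarrow> real fls mat" where
  "A0 N h f u v = pi_minus N (f (Lplus N h u v)) - sigma N h (f (Lplus N h u v))"

text \<open>
  The triad equations at the point \<open>(u, v)\<close>: they define an evolution, with velocity \<open>(u', v')\<close>.
\<close>

definition triad :: "nat \<Rightarrow> real \<Rightarrow> (real fls mat \<Rightarrow> real fls mat) \<Rightarrow>
    (nat \<Rightarrow> real) \<Rightarrow> (nat \<Rightarrow> real) \<Rightarrow> real fls mat \<Rightarrow> real fls mat \<Rightarrow>
    (nat \<Rightarrow> real) \<Rightarrow> (nat \<Rightarrow> real) \<Rightarrow> bool" where
  "triad N h f u v A1 A2 u' v' \<longleftrightarrow>
     A1 \<in> loop_algebra N \<and> A2 \<in> loop_algebra N \<and>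
     A1 * Fmat N h = Fmat N h * A0 N h f u v \<and>
     A1 * Umat N u - Umat N u * A2 = msum N (\<lambda>k. fls_const (u' k) \<cdot>\<^sub>m munit N k k) \<and>
     A2 * Vmat N v - Vmat N v * A0 N h f u v =
       fls_X_inv \<cdot>\<^sub>m msum N (\<lambda>k. fls_const (v' k) \<cdot>\<^sub>m munit N k (k + 1))"

definition compatible :: "nat \<Rightarrow> real \<Rightarrow> (real fls mat \<Rightarrow> real fls mat) \<Rightarrow>
    (nat \<Rightarrow> real) \<Rightarrow> (nat \<Rightarrow> real) \<Rightarrow> real fls mat \<Rightarrow> real fls mat \<Rightarrow> bool" where
  "compatible N h f u v A1 A2 \<longleftrightarrow> (\<exists>u' v'. triad N h f u v A1 A2 u' v')"

definition coeffs_continuous ::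
    "nat \<Rightarrow> ((nat \<Rightarrow> real) \<times> (nat \<Rightarrow> real) \<Rightarrow> real fls mat) \<Rightarrow> bool" where
  "coeffs_continuous N X \<longleftrightarrow>
     (\<forall>i<N. \<forall>j<N. \<forall>p. continuous_on UNIV (\<lambda>w. fls_nth (X w $$ (i, j)) p))"

text \<open>
  The pair \<open>(A1, A2)\<close> as a continuous matrix-valued function on the phase space, compatible
  everywhere. Continuity matters: at a point where some \<open>u k\<close> and some \<open>v j\<close> vanish, the
  equations at that single point need not determine \<open>A2\<close>. For instance, at \<open>u = v = 0\<close> and
  \<open>f = id\<close> every \<open>A2 = diag(c) * Emat_inv N\<close> is compatible.
\<close>

definition compatible_field :: "nat \<Rightarrow> real \<Rightarrow> (real fls mat \<Rightarrow> real fls mat) \<Rightarrow>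
    ((nat \<Rightarrow> real) \<times> (nat \<Rightarrow> real) \<Rightarrow> real fls mat \<times> real fls mat) \<Rightarrow> bool" where
  "compatible_field N h f A \<longleftrightarrow>
     coeffs_continuous N (fst \<circ> A) \<and> coeffs_continuous N (snd \<circ> A) \<and>
     (\<forall>u v. compatible N h f u v (fst (A (u, v))) (snd (A (u, v))))"

text \<open>The differential equations of the triad along a curve, at time \<open>t\<close>.\<close>

definition lax_flow :: "nat \<Rightarrow> real \<Rightarrow> (real fls mat \<Rightarrow> real fls mat) \<Rightarrow>
    (real \<Rightarrow> nat \<Rightarrow> real) \<Rightarrow> (real \<Rightarrow> nat \<Rightarrow> real) \<Rightarrow> real fls mat \<Rightarrow> real fls mat \<Rightarrow> real \<Rightarrow> bool" where
  "lax_flow N h f u v A1 A2 t \<longleftrightarrow>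
     has_loop_derivative N (\<lambda>s. Umat N (u s)) (A1 * Umat N (u t) - Umat N (u t) * A2) t \<and>
     has_loop_derivative N (\<lambda>s. Vmat N (v s))
       (A2 * Vmat N (v t) - Vmat N (v t) * A0 N h f (u t) (v t)) t"

definition first_udot :: "nat \<Rightarrow> real \<Rightarrow> (nat \<Rightarrow> real) \<Rightarrow> (nat \<Rightarrow> real) \<Rightarrow> nat \<Rightarrow> real" where
  "first_udot N h u v k = (let k' = (k + N - 1) mod N in
     u k * (v k - v k' + h * u k * v k - h * u k' * v k'))"

definition first_vdot :: "nat \<Rightarrow> real \<Rightarrow> (nat \<Rightarrow> real) \<Rightarrow> (nat \<Rightarrow> real) \<Rightarrow> nat \<Rightarrow> real" where
  "first_vdot N h u v k = (let k' = (k + 1) mod N in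
     v k * (u k' - u k + h * u k' * v k' - h * u k * v k))"

definition first_A0 :: "nat \<Rightarrow> real \<Rightarrow> (nat \<Rightarrow> real) \<Rightarrow> (nat \<Rightarrow> real) \<Rightarrow> real fls mat" where
  "first_A0 N h u v =
     fls_X_inv \<cdot>\<^sub>m msum N (\<lambda>k. fls_const (u k * v k) \<cdot>\<^sub>m munit N k (k + 1))
     - fls_const h \<cdot>\<^sub>m msum N (\<lambda>k. fls_const (u k * v k) \<cdot>\<^sub>m munit N k k)"

definition first_A1 :: "nat \<Rightarrow> real \<Rightarrow> (nat \<Rightarrow> real) \<Rightarrow> (nat \<Rightarrow> real) \<Rightarrow> real fls mat" where
  "first_A1 N h u v =
     fls_X_inv \<cdot>\<^sub>m msum N (\<lambda>k. fls_const (u k * v k) \<cdot>\<^sub>m munit N k (k + 1))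
     - fls_const h \<cdot>\<^sub>m msum N (\<lambda>k. fls_const
         (u ((k + N - 1) mod N) * v ((k + N - 1) mod N)) \<cdot>\<^sub>m munit N k k)"

definition first_A2 :: "nat \<Rightarrow> real \<Rightarrow> (nat \<Rightarrow> real) \<Rightarrow> (nat \<Rightarrow> real) \<Rightarrow> real fls mat" where
  "first_A2 N h u v =
     fls_X_inv \<cdot>\<^sub>m msum N (\<lambda>k. fls_const (u ((k + 1) mod N) * v k) \<cdot>\<^sub>m munit N k (k + 1))
     - fls_const h \<cdot>\<^sub>m msum N (\<lambda>k. fls_const (u k * v k) \<cdot>\<^sub>m munit N k k)"

end

theory Submission
  imports Defs "Jordan_Normal_Form.Determinant" "HOL-Analysis.Function_Metric"
begin

text \<open>
  Over the field of formal Laurent series, \<open>U\<close> and \<open>V\<close> are invertible at every point of the phase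
  space, even where some \<open>u k\<close> or \<open>v k\<close> vanish. Covariance therefore gives \<open>f (X Y) X = X f (Y X)\<close>
  for \<open>X = F, U, V\<close>, so \<open>T0 = f (F\<inverse> U V)\<close>, \<open>T1 = f (U V F\<inverse>)\<close>, \<open>T2 = f (V F\<inverse> U)\<close> satisfy
  \<open>T1 F = F T0\<close>, \<open>T1 U = U T2\<close>, \<open>T2 V = V T0\<close>. Truncate each \<open>Ti\<close> to its negative part and add the
  diagonal terms \<open>- s k\<close>, \<open>- s (k - 1)\<close>, \<open>- s k\<close>, where \<open>s = \<sigma>(T0)\<close>. As \<open>U\<close>, \<open>V\<close>, \<open>F\<close> have
  two adjacent degrees only, the truncation errors are confined to the degrees in which \<open>U\<close> and \<open>V\<close>
  move, and the equation for \<open>F\<close> in degree \<open>0\<close> is the telescoped sum of \<open>T1 F = F T0\<close> over the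
  negative degrees. Uniqueness of \<open>A1\<close> is invertibility of \<open>F\<close>; the difference of two candidates
  for \<open>A2\<close> obeys two first-order recursions in the degree, which annihilate it when no \<open>u k\<close> (or
  no \<open>v k\<close>) vanishes, and such points are dense.
\<close>

section \<open>Cyclic coefficients and monomial matrices\<close>

definition res :: "nat \<Rightarrow> int \<Rightarrow> nat" where
  "res N i = nat (i mod int N)"

text \<open>
  \<open>lcoeff\<close> with the diagonal index running over all integers, read modulo \<open>N\<close>: products with
  \<open>Umat\<close>, \<open>Vmat\<close>, \<open>Fmat\<close> then become two-term formulas without wrap-around.
\<close>

definition tcoeff :: "nat \<Rightarrow> real fls mat \<Rightarrow> int \<Rightarrow> int \<Rightarrow> real" where
  "tcoeff N M p i = fls_nth (M $$ (res N i, res N (i - p))) p"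

lemma fls_times_nth_nonzeroD:
  fixes f g :: "'a::semiring_0 fls"
  assumes "fls_nth (f * g) n \<noteq> 0"
  shows "\<exists>q. fls_nth f q \<noteq> 0 \<and> fls_nth g (n - q) \<noteq> 0"
proof (rule ccontr)
  assume "\<not> ?thesis"
  then have "fls_nth f q * fls_nth g (n - q) = 0" for q by (metis mult_zero_left mult_zero_right)
  then show False using assms by (simp add: fls_times_nth(2))
qed

lemma mult_mat_index_sum:
  assumes "A \<in> carrier_mat N N" "B \<in> carrier_mat N N" "i < N" "j < N"
  shows "(A * B) $$ (i, j) = (\<Sum>k<N. A $$ (i, k) * B $$ (k, j))"
  using assms by (simp add: scalar_prod_def lessThan_atLeast0)

text \<open>The monomial diag(d) * \<open>Epow N q\<close>, written out entrywise.
  \<open>Umat\<close>, \<open>Vmat\<close> and \<open>Fmat\<close> are sums or differences of two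
  such monomials, and each velocity in the triad is a single one.\<close>

definition diag_Epow :: "nat \<Rightarrow> (nat \<Rightarrow> real) \<Rightarrow> int \<Rightarrow> real fls mat" where
  "diag_Epow N d q = mat N N (\<lambda>(i, j).
     if int i mod int N = (int j + q) mod int N then fls_const (d i) * fls_X_intpow q else 0)"

text \<open>The integer index makes the cyclic predecessor \<open>i - 1\<close>, which enters A1,
  directly expressible.\<close>

definition sigma_entry :: "nat \<Rightarrow> real \<Rightarrow> real fls mat \<Rightarrow> int \<Rightarrow> real" where
  "sigma_entry N h M i = (\<Sum>p | p < 0 \<and> tcoeff N M p i \<noteq> 0. h ^ nat (- p) * tcoeff N M p i)"

lemma diag_Epow_carrier [simp]: "diag_Epow N d q \<in> carrier_mat N N"
  by (simp add: diag_Epow_def)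

lemma msum_munit_index:
  assumes "i < N" "j < N"
  shows "msum N (\<lambda>k. fls_const (d k) \<cdot>\<^sub>m munit N k (k + b)) $$ (i, j) =
    (if int i mod int N = (int j - int b) mod int N then fls_const (d i) else 0)"
proof -
  have "msum N (\<lambda>k. fls_const (d k) \<cdot>\<^sub>m munit N k (k + b)) $$ (i, j) =
      (\<Sum>k<N. (fls_const (d k) \<cdot>\<^sub>m munit N k (k + b)) $$ (i, j))"
    using assms by (simp add: msum_def)
  also have "\<dots> = (\<Sum>k<N. if k = i then (if j = (i + b) mod N then fls_const (d i) else 0) else 0)"
    by (rule sum.cong[OF refl]) (use assms in \<open>auto simp: munit_def\<close>)
  also have "\<dots> = (if j = (i + b) mod N then fls_const (d i) else 0)"
    using assms by simp
  also have "j = (i + b) mod N \<longleftrightarrow> int j mod int N = (int i + int b) mod int N"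
    using assms by (metis mod_less of_nat_add of_nat_eq_iff zmod_int)
  also have "\<dots> \<longleftrightarrow> int i mod int N = (int j - int b) mod int N"
    by (smt (verit) mod_eq_dvd_iff dvd_minus_iff)
  finally show ?thesis .
qed

lemma diag_Epow_0: "msum N (\<lambda>k. fls_const (d k) \<cdot>\<^sub>m munit N k k) = diag_Epow N d 0"
  by (rule eq_matI)
     (use msum_munit_index[of _ N _ d 0] in \<open>auto simp: diag_Epow_def msum_def\<close>)

lemma diag_Epow_minus_1:
  "fls_X_inv \<cdot>\<^sub>m msum N (\<lambda>k. fls_const (d k) \<cdot>\<^sub>m munit N k (k + 1)) = diag_Epow N d (- 1)"
proof (rule eq_matI)
  fix i j assume "i < dim_row (diag_Epow N d (- 1))" "j < dim_col (diag_Epow N d (- 1))"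
  then have ij: "i < N" "j < N" by (auto simp: diag_Epow_def)
  have "(fls_X_inv \<cdot>\<^sub>m msum N (\<lambda>k. fls_const (d k) \<cdot>\<^sub>m munit N k (k + 1))) $$ (i, j) =
      fls_X_inv * msum N (\<lambda>k. fls_const (d k) \<cdot>\<^sub>m munit N k (k + 1)) $$ (i, j)"
    using ij by (simp add: msum_def)
  then show "(fls_X_inv \<cdot>\<^sub>m msum N (\<lambda>k. fls_const (d k) \<cdot>\<^sub>m munit N k (k + 1))) $$ (i, j) =
      diag_Epow N d (- 1) $$ (i, j)"
    using ij msum_munit_index[OF ij, of d 1]
    by (auto simp: diag_Epow_def fls_X_inv_conv_shift_1 mult.commute)
qed (auto simp: diag_Epow_def msum_def)

lemma diag_Epow_1:
  "(fls_const c * fls_X) \<cdot>\<^sub>m msum N (\<lambda>k. munit N (k + 1) k) = diag_Epow N (\<lambda>_. c) 1"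
proof (rule eq_matI)
  fix i j assume "i < dim_row (diag_Epow N (\<lambda>_. c) 1)" "j < dim_col (diag_Epow N (\<lambda>_. c) 1)"
  then have ij: "i < N" "j < N" by (auto simp: diag_Epow_def)
  have "((fls_const c * fls_X) \<cdot>\<^sub>m msum N (\<lambda>k. munit N (k + 1) k)) $$ (i, j) =
      (fls_const c * fls_X) * msum N (\<lambda>k. munit N (k + 1) k) $$ (i, j)"
    using ij by (simp add: msum_def)
  then show "((fls_const c * fls_X) \<cdot>\<^sub>m msum N (\<lambda>k. munit N (k + 1) k)) $$ (i, j) =
      diag_Epow N (\<lambda>_. c) 1 $$ (i, j)"
    using ij msum_up_index[OF ij] by (auto simp: diag_Epow_def fls_X_conv_shift_1)
qed (auto simp: diag_Epow_def msum_def)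

lemma one_eq_diag_Epow: "1\<^sub>m N = diag_Epow N (\<lambda>_. 1) 0"
  by (rule eq_matI) (auto simp: diag_Epow_def)

lemma smult_diag_Epow: "fls_const c \<cdot>\<^sub>m diag_Epow N d q = diag_Epow N (\<lambda>k. c * d k) q"
  by (rule eq_matI) (auto simp: diag_Epow_def mult.assoc simp flip: fls_const_mult_const)

lemma Umat_eq: "Umat N u = diag_Epow N u 0 + diag_Epow N (\<lambda>_. 1) 1"
  unfolding Umat_def diag_Epow_0 using diag_Epow_1[of 1 N] by simp

lemma Vmat_eq: "Vmat N v = diag_Epow N (\<lambda>_. 1) 0 + diag_Epow N v (- 1)"
  by (simp only: Vmat_def diag_Epow_minus_1 one_eq_diag_Epow)

lemma Fmat_eq: "Fmat N h = diag_Epow N (\<lambda>_. 1) 0 - diag_Epow N (\<lambda>_. h) 1"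
  by (simp only: Fmat_def diag_Epow_1 one_eq_diag_Epow)

text \<open>Without positive degrees in A0 and A1, degree 1 of the equation for F reads h a1(i) = h
  a0(i - 1) on the diagonal terms. Hence the diagonal of A0 reappears with its index lowered
  cyclically; for h = 0 both diagonals vanish.\<close>

definition triad_A1 :: "nat \<Rightarrow> real \<Rightarrow> (real fls mat \<Rightarrow> real fls mat) \<Rightarrow>
    (nat \<Rightarrow> real) \<Rightarrow> (nat \<Rightarrow> real) \<Rightarrow> real fls mat" where
  "triad_A1 N h f u v = pi_minus N (f (Umat N u * Vmat N v * Fmat_inv N h))
     - diag_Epow N (\<lambda>k. sigma_entry N h (f (Lplus N h u v)) (int k - 1)) 0"

text \<open>
  \<open>f (V F\<inverse> U)\<close> equals \<open>V f (L\<^sub>+) V\<inverse>\<close>, but \<open>V\<inverse>\<close> does not depend continuously on \<open>v\<close> (for \<open>N = 1\<close>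
  it is \<open>\<lambda> / (\<lambda> + v)\<close>), so only the former shows that \<open>A2\<close> is continuous.
\<close>

definition triad_A2 :: "nat \<Rightarrow> real \<Rightarrow> (real fls mat \<Rightarrow> real fls mat) \<Rightarrow>
    (nat \<Rightarrow> real) \<Rightarrow> (nat \<Rightarrow> real) \<Rightarrow> real fls mat" where
  "triad_A2 N h f u v = pi_minus N (f (Vmat N v * Fmat_inv N h * Umat N u))
     - diag_Epow N (\<lambda>k. sigma_entry N h (f (Lplus N h u v)) (int k)) 0"

section \<open>Induction over degrees and a criterion for trivial kernels\<close>

lemma int_ascend:
  fixes p :: int
  assumes "\<forall>p<b. P p" "\<And>p. p < c \<Longrightarrow> P (p - 1) \<Longrightarrow> P p" "p < c"
  shows "P p"
  using assms(3)
\<comment> \<open>The measure is 0 exactly when \<open>p < b\<close>, where P is given.\<close>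
proof (induction "nat (p - b + 1)" arbitrary: p)
  case 0
  then show ?case using assms(1) by simp
next
  case (Suc n)
  then show ?case using assms(2)[of p] Suc(1)[of "p - 1"] by simp
qed

text \<open>The reflection of p to -p reduces descent to ascent.\<close>

lemma int_descend:
  fixes p :: int
  assumes "\<forall>p>b. P p" "\<And>p. p > c \<Longrightarrow> P (p + 1) \<Longrightarrow> P p" "p > c"
  shows "P p"
proof -
  have "P (- (- p))"
    by (rule int_ascend[of "- b" "\<lambda>p. P (- p)" "- c"]) (use assms in \<open>auto simp: add.commute\<close>)
  then show ?thesis by simp
qed

text \<open>A nonzero component of maximal subdegree would contradict the step, and a maximum exists
  because there are finitely many components. The criterion is applied to kernel vectors of U and
  V.\<close>

lemma fls_vec_eq_0I:
  fixes w :: "'a::zero fls vec"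
  assumes w: "w \<in> carrier_vec N"
    and step: "\<And>k. k < N \<Longrightarrow> w $ k \<noteq> 0 \<Longrightarrow>
      \<exists>m<N. w $ m \<noteq> 0 \<and> fls_subdegree (w $ k) < fls_subdegree (w $ m)"
  shows "w = 0\<^sub>v N"
proof (rule ccontr)
  assume "w \<noteq> 0\<^sub>v N"
  let ?S = "{k. k < N \<and> w $ k \<noteq> 0}"
  have "?S \<noteq> {}"
  proof
    assume "?S = {}"
    then have "w = 0\<^sub>v N" by (intro eq_vecI) (use w in auto)
    then show False using \<open>w \<noteq> 0\<^sub>v N\<close> by simp
  qed
  define D where "D = (\<lambda>k. fls_subdegree (w $ k)) ` ?S"
  have "finite D" "D \<noteq> {}" using \<open>?S \<noteq> {}\<close> by (simp_all add: D_def)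
  then have "Max D \<in> D" by (rule Max_in)
  then obtain k where "k \<in> ?S" "Max D = fls_subdegree (w $ k)"
    unfolding D_def by blast
  moreover have "fls_subdegree (w $ m) \<le> Max D" if "m \<in> ?S" for m
    using that \<open>finite D\<close> by (intro Max_ge) (auto simp: D_def)
  ultimately show False using step[of k] by fastforce
qed

section \<open>Continuity of coordinates and case distinctions on constant conditions\<close>

lemma continuous_on_fst_coordinate [continuous_intros]:
  "continuous_on S (\<lambda>w :: (nat \<Rightarrow> real) \<times> (nat \<Rightarrow> real). fst w k)"
  by (rule continuous_on_product_then_coordinatewise[of S fst]) (intro continuous_intros)

lemma continuous_on_snd_coordinate [continuous_intros]:
  "continuous_on S (\<lambda>w :: (nat \<Rightarrow> real) \<times> (nat \<Rightarrow> real). snd w k)"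
  by (rule continuous_on_product_then_coordinatewise[of S snd]) (intro continuous_intros)

lemma continuous_on_If_const [continuous_intros]:
  "continuous_on S f \<Longrightarrow> continuous_on S g \<Longrightarrow> continuous_on S (\<lambda>x. if P then f x else g x)"
  by (cases P) simp_all

lemma has_real_derivative_If_const:
  assumes "P \<Longrightarrow> (f has_real_derivative D) (at t)" "\<not> P \<Longrightarrow> (g has_real_derivative E) (at t)"
  shows "((\<lambda>s. if P then f s else g s) has_real_derivative (if P then D else E)) (at t)"
  using assms by (cases P) simp_all

context
  fixes N :: nat
  assumes N_pos: "N > 0"
begin

section \<open>Integer representatives of residues modulo N\<close>

lemma res_less [simp]: "res N i < N"
  using N_pos by (simp add: res_def nat_less_iff)

lemma int_res [simp]: "int (res N i) = i mod int N"
  using N_pos by (simp add: res_def)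

lemma res_of_nat [simp]: "i < N \<Longrightarrow> res N (int i) = i"
  by (simp add: res_def)

lemma res_eq_iff: "res N i = res N j \<longleftrightarrow> i mod int N = j mod int N"
  by (metis int_res of_nat_eq_iff)

lemma eq_res_iff: "k < N \<Longrightarrow> k = res N i \<longleftrightarrow> int k mod int N = i mod int N"
  by (metis res_eq_iff res_of_nat)

lemma res_diff_eq:
  assumes "int i mod int N = (int j + p) mod int N" "j < N"
  shows "res N (int i - p) = j"
proof -
  have "(int i - p) mod int N = (int j + p - p) mod int N"
    by (rule mod_diff_cong) (use assms in auto)
  then show ?thesis using assms eq_res_iff[of j "int i - p"] by simp
qed

lemma res_mod [simp]: "res N (i mod int N) = res N i"
  by (simp add: res_eq_iff)

lemma res_mod_diff [simp]: "res N (i mod int N - p) = res N (i - p)"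
  by (simp add: res_eq_iff mod_simps)

section \<open>The grading: entries of twisted matrices and their coefficients\<close>

lemma tcoeff_mod [simp]: "tcoeff N M p (i mod int N) = tcoeff N M p i"
  by (simp add: tcoeff_def)

lemma lcoeff_eq_tcoeff: "i < N \<Longrightarrow> lcoeff N M p i = tcoeff N M p (int i)"
  by (simp add: lcoeff_def tcoeff_def) (simp add: res_def)

text \<open>Twisting is a congruence between the position of an entry and the degrees occurring in
  it. A common lower bound for the degrees comes for free, since finitely many entries each have a
  lowest degree.\<close>

lemma loop_series_iff:
  "M \<in> loop_series N \<longleftrightarrow> M \<in> carrier_mat N N \<and>
    (\<forall>i<N. \<forall>j<N. \<forall>p. fls_nth (M $$ (i, j)) p \<noteq> 0 \<longrightarrow> int i mod int N = (int j + p) mod int N)"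
  (is "_ \<longleftrightarrow> ?carrier \<and> ?graded")
proof
  assume "M \<in> loop_series N"
  then obtain l b where M: "M = loop N l" and b: "\<And>p i. p < b \<Longrightarrow> i < N \<Longrightarrow> l p i = 0"
    by (auto simp: loop_series_def)
  have "?graded"
    using loop_nth[of _ N _ b l] b by (auto simp: M split: if_splits)
  moreover have ?carrier by (simp add: M loop_def)
  ultimately show "?carrier \<and> ?graded" by simp
next
  assume *: "?carrier \<and> ?graded"
  \<comment> \<open>Zero entries contribute the default subdegree 0, which is harmless because only
    a lower bound is wanted.\<close>
  define b where "b = Min ((\<lambda>(i, j). fls_subdegree (M $$ (i, j))) ` ({..<N} \<times> {..<N}))"
  have b: "fls_nth (M $$ (i, j)) p = 0" if "p < b" "i < N" "j < N" for i j p
  proof (rule fls_eq0_below_subdegree)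
    have "b \<le> fls_subdegree (M $$ (i, j))"
      unfolding b_def by (rule Min_le) (use that in auto)
    then show "p < fls_subdegree (M $$ (i, j))" using that by simp
  qed
  have lb: "tcoeff N M p (int i) = 0" if "p < b" for p i
    unfolding tcoeff_def by (rule b[OF that]) auto
  have "M = loop N (\<lambda>p i. tcoeff N M p (int i))" (is "_ = ?L")
  proof (rule eq_matI)
    fix i j
    assume "i < dim_row ?L" and "j < dim_col ?L"
    then have ij: "i < N" "j < N" by (auto simp: loop_def)
    show "M $$ (i, j) = ?L $$ (i, j)"
    proof (rule fls_eqI)
      fix p
      have L: "fls_nth (?L $$ (i, j)) p =
          (if int i mod int N = (int j + p) mod int N then tcoeff N M p (int i) else 0)"
        by (rule loop_nth[of i N j b]) (use ij lb in auto)
      show "fls_nth (M $$ (i, j)) p = fls_nth (?L $$ (i, j)) p"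
      proof (cases "int i mod int N = (int j + p) mod int N")
        case True
        have "tcoeff N M p (int i) = fls_nth (M $$ (i, j)) p"
          unfolding tcoeff_def res_diff_eq[OF True ij(2)] using ij by simp
        then show ?thesis using L True by simp
      next
        case False
        then show ?thesis using L * ij by auto
      qed
    qed
  qed (use * in \<open>auto simp: loop_def\<close>)
  then show "M \<in> loop_series N"
    unfolding loop_series_def using lb by blast
qed

lemma loop_series_carrier [simp]: "M \<in> loop_series N \<Longrightarrow> M \<in> carrier_mat N N"
  by (simp add: loop_series_iff)

lemma loop_series_nth:
  assumes "M \<in> loop_series N" "i < N" "j < N"
  shows "fls_nth (M $$ (i, j)) p =
    (if int i mod int N = (int j + p) mod int N then tcoeff N M p (int i) else 0)"
proof (cases "int i mod int N = (int j + p) mod int N")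
  case True
  have "tcoeff N M p (int i) = fls_nth (M $$ (i, j)) p"
    unfolding tcoeff_def res_diff_eq[OF True assms(3)] using assms by simp
  then show ?thesis using True by simp
qed (use assms in \<open>auto simp: loop_series_iff\<close>)

text \<open>By the grading, \<open>tcoeff\<close> sees every coefficient that can be nonzero. Most
  matrix identities below are checked degree by degree through this rule.\<close>

lemma loop_series_eqI:
  assumes "M \<in> loop_series N" "K \<in> loop_series N" "\<And>p i. tcoeff N M p i = tcoeff N K p i"
  shows "M = K"
proof (rule eq_matI)
  have "M \<in> carrier_mat N N" "K \<in> carrier_mat N N" using assms by simp_all
  then show "dim_row M = dim_row K" "dim_col M = dim_col K" by auto
  show "M $$ (i, j) = K $$ (i, j)" if "i < dim_row K" "j < dim_col K" for i j
  proof (rule fls_eqI)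
    have "i < N" "j < N" using that \<open>K \<in> carrier_mat N N\<close> by auto
    then show "fls_nth (M $$ (i, j)) p = fls_nth (K $$ (i, j)) p" for p
      by (simp only: loop_series_nth assms)
  qed
qed

lemma loop_series_bound:
  assumes "M \<in> loop_series N"
  shows "\<exists>b. \<forall>p<b. \<forall>i. tcoeff N M p i = 0"
proof -
  obtain l b where M: "M = loop N l" and b: "\<And>p i. p < b \<Longrightarrow> i < N \<Longrightarrow> l p i = 0"
    using assms by (auto simp: loop_series_def)
  have "tcoeff N M p i = 0" if "p < b" for p i
    using loop_nth[of "res N i" N "res N (i - p)" b l p] b that by (simp add: tcoeff_def M)
  then show ?thesis by blast
qed

lemma tcoeff_loop:
  assumes "\<And>p i. p < b \<Longrightarrow> i < N \<Longrightarrow> l p i = 0"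
  shows "tcoeff N (loop N l) p i = l p (res N i)"
  using loop_nth[of "res N i" N "res N (i - p)" b l p] assms by (simp add: tcoeff_def mod_simps)

lemma loop_in_series:
  assumes "\<And>p i. p < b \<Longrightarrow> i < N \<Longrightarrow> l p i = 0"
  shows "loop N l \<in> loop_series N"
  using assms by (auto simp: loop_series_def)

text \<open>A series is already bounded below, so an upper bound leaves finitely many
  degrees.\<close>

lemma loop_algebra_iff:
  "M \<in> loop_algebra N \<longleftrightarrow> M \<in> loop_series N \<and> (\<exists>b. \<forall>p>b. \<forall>i. tcoeff N M p i = 0)"
proof
  assume "M \<in> loop_algebra N"
  then obtain l where M: "M = loop N l" and fin: "finite {p. \<exists>i<N. l p i \<noteq> 0}" (is "finite ?S")
    by (auto simp: loop_algebra_def)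
  \<comment> \<open>Inserting 0 keeps \<open>Min\<close> and \<open>Max\<close> meaningful when no
    degree occurs.\<close>
  have lo: "l p i = 0" if "p < Min (insert 0 ?S)" "i < N" for p i
    using that fin Min_le[of "insert 0 ?S" p] by force
  have hi: "l p i = 0" if "p > Max (insert 0 ?S)" "i < N" for p i
    using that fin Max_ge[of "insert 0 ?S" p] by force
  have "M \<in> loop_series N"
    unfolding M by (rule loop_in_series) (rule lo)
  moreover have "tcoeff N M p i = l p (res N i)" for p i
    unfolding M by (rule tcoeff_loop) (rule lo)
  ultimately show "M \<in> loop_series N \<and> (\<exists>b. \<forall>p>b. \<forall>i. tcoeff N M p i = 0)"
    by (auto intro!: exI[of _ "Max (insert 0 ?S)"] hi)
next
  assume M: "M \<in> loop_series N \<and> (\<exists>b. \<forall>p>b. \<forall>i. tcoeff N M p i = 0)"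
  then obtain b where hi: "\<And>p i. p > b \<Longrightarrow> tcoeff N M p i = 0" by blast
  obtain a where lo: "\<And>p i. p < a \<Longrightarrow> tcoeff N M p i = 0"
    using loop_series_bound[OF conjunct1[OF M]] by blast
  let ?l = "\<lambda>p i. tcoeff N M p (int i)"
  have "M = loop N ?l"
  proof (rule loop_series_eqI)
    show "loop N ?l \<in> loop_series N" by (rule loop_in_series) (rule lo)
    have "tcoeff N (loop N ?l) p i = ?l p (res N i)" for p i
      by (rule tcoeff_loop) (rule lo)
    then show "tcoeff N M p i = tcoeff N (loop N ?l) p i" for p i by simp
  qed (use M in simp)
  moreover have "{p. \<exists>i<N. ?l p i \<noteq> 0} \<subseteq> {a..b}"
  proof
    fix p assume "p \<in> {p. \<exists>i<N. ?l p i \<noteq> 0}"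
    then obtain i where "?l p i \<noteq> 0" by blast
    then have "\<not> p < a" "\<not> p > b" using lo hi by blast+
    then show "p \<in> {a..b}" by simp
  qed
  then have "finite {p. \<exists>i<N. ?l p i \<noteq> 0}"
    by (rule finite_subset) simp
  ultimately show "M \<in> loop_algebra N" unfolding loop_algebra_def by blast
qed

lemma loop_algebra_series [simp]: "M \<in> loop_algebra N \<Longrightarrow> M \<in> loop_series N"
  by (simp add: loop_algebra_iff)

text \<open>The congruences add up: q = i - k and p - q = k - j modulo N give p = i - j.\<close>

lemma loop_series_mult [simp]:
  assumes A: "A \<in> loop_series N" and B: "B \<in> loop_series N"
  shows "A * B \<in> loop_series N"
  unfolding loop_series_iff
proof (intro conjI allI impI)
  fix i j p
  assume ij: "i < N" "j < N" and nz: "fls_nth ((A * B) $$ (i, j)) p \<noteq> 0"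
  have "(\<Sum>k<N. fls_nth (A $$ (i, k) * B $$ (k, j)) p) \<noteq> 0"
    using mult_mat_index_sum[OF loop_series_carrier[OF A] loop_series_carrier[OF B] ij]
      nz by (simp only: fls_nth_sum not_False_eq_True)
  then obtain k where k: "k < N" "fls_nth (A $$ (i, k) * B $$ (k, j)) p \<noteq> 0"
    by (metis (no_types, lifting) lessThan_iff sum.not_neutral_contains_not_neutral)
  then obtain q where q: "fls_nth (A $$ (i, k)) q \<noteq> 0" "fls_nth (B $$ (k, j)) (p - q) \<noteq> 0"
    using fls_times_nth_nonzeroD by blast
  have "int i mod int N = (int k + q) mod int N" "int k mod int N = (int j + (p - q)) mod int N"
    using A B q ij k by (auto simp: loop_series_iff)
  then have "int i mod int N = (int j + (p - q) + q) mod int N"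
    by (metis mod_add_left_eq)
  then show "int i mod int N = (int j + p) mod int N" by simp
next
  show "A * B \<in> carrier_mat N N"
    using mult_carrier_mat[OF loop_series_carrier[OF A] loop_series_carrier[OF B]] .
qed

lemma loop_series_add [simp]:
  assumes "A \<in> loop_series N" "B \<in> loop_series N"
  shows "A + B \<in> loop_series N"
proof -
  note carrier_matD[OF loop_series_carrier[OF assms(1)], simp]
    carrier_matD[OF loop_series_carrier[OF assms(2)], simp]
  show ?thesis
    unfolding loop_series_iff by (auto simp: loop_series_nth assms carrier_matI split: if_splits)
qed

lemma loop_series_minus [simp]:
  assumes "A \<in> loop_series N" "B \<in> loop_series N"
  shows "A - B \<in> loop_series N"
proof -
  note carrier_matD[OF loop_series_carrier[OF assms(1)], simp]
    carrier_matD[OF loop_series_carrier[OF assms(2)], simp]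
  show ?thesis
    unfolding loop_series_iff by (auto simp: loop_series_nth assms carrier_matI split: if_splits)
qed

lemma tcoeff_add [simp]:
  assumes "B \<in> carrier_mat N N"
  shows "tcoeff N (A + B) p i = tcoeff N A p i + tcoeff N B p i"
  using assms by (simp add: tcoeff_def)

lemma tcoeff_minus [simp]:
  assumes "B \<in> carrier_mat N N"
  shows "tcoeff N (A - B) p i = tcoeff N A p i - tcoeff N B p i"
  using assms by (simp add: tcoeff_def)

section \<open>Coefficients of products with monomials\<close>

lemma diag_Epow_nth:
  assumes "i < N" "j < N"
  shows "fls_nth (diag_Epow N d q $$ (i, j)) p =
    (if p = q \<and> int i mod int N = (int j + q) mod int N then d i else 0)"
  using assms by (auto simp: diag_Epow_def)

lemma diag_Epow_series [simp]: "diag_Epow N d q \<in> loop_series N"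
  unfolding loop_series_iff by (auto simp: diag_Epow_nth split: if_splits)

lemma tcoeff_diag_Epow: "tcoeff N (diag_Epow N d q) p i = (if p = q then d (res N i) else 0)"
  by (auto simp: tcoeff_def diag_Epow_nth mod_simps)

lemma diag_Epow_algebra [simp]: "diag_Epow N d q \<in> loop_algebra N"
  unfolding loop_algebra_iff by (auto simp: tcoeff_diag_Epow intro!: exI[of _ q])

text \<open>Only one summand of the matrix product survives. Moving d to the left past the power
  \<open>p - q\<close> of \<open>Emat\<close> shifts its index by that power.\<close>

lemma tcoeff_mult_diag_Epow:
  assumes "M \<in> carrier_mat N N"
  shows "tcoeff N (M * diag_Epow N d q) p i = tcoeff N M (p - q) i * d (res N (i - (p - q)))"
proof -
  define m where "m = res N (i - (p - q))"
  have "(M * diag_Epow N d q) $$ (res N i, res N (i - p)) =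
      (\<Sum>k<N. if k = m then M $$ (res N i, m) * (fls_const (d m) * fls_X_intpow q) else 0)"
  proof (subst mult_mat_index_sum[OF assms diag_Epow_carrier], simp, simp, rule sum.cong[OF refl])
    fix k assume k: "k \<in> {..<N}"
    have "int k mod int N = (int (res N (i - p)) + q) mod int N \<longleftrightarrow> k = m"
      using k by (simp add: m_def eq_res_iff mod_simps algebra_simps)
    then show "M $$ (res N i, k) * diag_Epow N d q $$ (k, res N (i - p)) =
        (if k = m then M $$ (res N i, m) * (fls_const (d m) * fls_X_intpow q) else 0)"
      using k by (simp add: diag_Epow_def)
  qed
  also have "\<dots> = fls_const (d m) * (fls_X_intpow q * M $$ (res N i, m))"
    by (simp add: m_def mult_ac)
  finally show ?thesis
    by (simp add: tcoeff_def fls_X_intpow_times_conv_shift m_def)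
qed

text \<open>Here the power q of \<open>Emat\<close> moves past the coefficients of M, which lowers
  their index by q.\<close>

lemma tcoeff_diag_Epow_mult:
  assumes "M \<in> carrier_mat N N"
  shows "tcoeff N (diag_Epow N d q * M) p i = d (res N i) * tcoeff N M (p - q) (i - q)"
proof -
  define m where "m = res N (i - q)"
  have "(diag_Epow N d q * M) $$ (res N i, res N (i - p)) =
      (\<Sum>k<N. if k = m then (fls_const (d (res N i)) * fls_X_intpow q) * M $$ (m, res N (i - p)) else 0)"
  proof (subst mult_mat_index_sum[OF diag_Epow_carrier assms], simp, simp, rule sum.cong[OF refl])
    fix k assume k: "k \<in> {..<N}"
    have "i mod int N = (int k + q) mod int N \<longleftrightarrow> k = m"
    proof
      assume "i mod int N = (int k + q) mod int N"
      then have "(i - q) mod int N = (int k + q - q) mod int N"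
        by (intro mod_diff_cong) auto
      then show "k = m" using k by (simp add: m_def eq_res_iff)
    qed (simp add: m_def mod_simps)
    then show "diag_Epow N d q $$ (res N i, k) * M $$ (k, res N (i - p)) =
        (if k = m then (fls_const (d (res N i)) * fls_X_intpow q) * M $$ (m, res N (i - p)) else 0)"
      using k by (simp add: diag_Epow_def)
  qed
  also have "\<dots> = fls_const (d (res N i)) * (fls_X_intpow q * M $$ (m, res N (i - p)))"
    by (simp add: m_def mult_ac)
  finally show ?thesis
    by (simp add: tcoeff_def fls_X_intpow_times_conv_shift m_def)
qed

section \<open>Two-term product formulas for U, V and F, and the inverse of F\<close>

lemma Umat_series [simp]: "Umat N u \<in> loop_series N"
  and Vmat_series [simp]: "Vmat N v \<in> loop_series N"
  and Fmat_series [simp]: "Fmat N h \<in> loop_series N"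
  by (simp_all add: Umat_eq Vmat_eq Fmat_eq)

lemma tcoeff_Umat:
  "tcoeff N (Umat N u) p i = (if p = 0 then u (res N i) else if p = 1 then 1 else 0)"
  by (simp add: Umat_eq tcoeff_diag_Epow)

lemma tcoeff_Vmat:
  "tcoeff N (Vmat N v) p i = (if p = - 1 then v (res N i) else if p = 0 then 1 else 0)"
  by (simp add: Vmat_eq tcoeff_diag_Epow)

lemma tcoeff_mult_Umat:
  assumes "M \<in> carrier_mat N N"
  shows "tcoeff N (M * Umat N u) p i = tcoeff N M p i * u (res N (i - p)) + tcoeff N M (p - 1) i"
  using assms
  by (simp add: Umat_eq mult_add_distrib_mat[OF _ diag_Epow_carrier diag_Epow_carrier] tcoeff_mult_diag_Epow)

lemma tcoeff_Umat_mult: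
  assumes "M \<in> carrier_mat N N"
  shows "tcoeff N (Umat N u * M) p i = u (res N i) * tcoeff N M p i + tcoeff N M (p - 1) (i - 1)"
  using assms
  by (simp add: Umat_eq add_mult_distrib_mat[OF diag_Epow_carrier diag_Epow_carrier] tcoeff_diag_Epow_mult
      mult_carrier_mat[OF diag_Epow_carrier])

lemma tcoeff_mult_Vmat:
  assumes "M \<in> carrier_mat N N"
  shows "tcoeff N (M * Vmat N v) p i =
    tcoeff N M p i + tcoeff N M (p + 1) i * v (res N (i - (p + 1)))"
  using assms
  by (simp add: Vmat_eq mult_add_distrib_mat[OF _ diag_Epow_carrier diag_Epow_carrier] tcoeff_mult_diag_Epow)

lemma tcoeff_Vmat_mult:
  assumes "M \<in> carrier_mat N N"
  shows "tcoeff N (Vmat N v * M) p i =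
    tcoeff N M p i + v (res N i) * tcoeff N M (p + 1) (i + 1)"
  using assms
  by (simp add: Vmat_eq add_mult_distrib_mat[OF diag_Epow_carrier diag_Epow_carrier] tcoeff_diag_Epow_mult
      mult_carrier_mat[OF diag_Epow_carrier])

lemma tcoeff_mult_Fmat:
  assumes "M \<in> carrier_mat N N"
  shows "tcoeff N (M * Fmat N h) p i = tcoeff N M p i - h * tcoeff N M (p - 1) i"
  using assms
  by (simp add: Fmat_eq mult_minus_distrib_mat[OF _ diag_Epow_carrier diag_Epow_carrier] tcoeff_mult_diag_Epow)

lemma tcoeff_Fmat_mult:
  assumes "M \<in> carrier_mat N N"
  shows "tcoeff N (Fmat N h * M) p i = tcoeff N M p i - h * tcoeff N M (p - 1) (i - 1)"
  using assms
  by (simp add: Fmat_eq minus_mult_distrib_mat[OF diag_Epow_carrier diag_Epow_carrier] tcoeff_diag_Epow_mult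
      mult_carrier_mat[OF diag_Epow_carrier])

lemmas two_term = tcoeff_mult_Fmat tcoeff_Fmat_mult tcoeff_mult_Umat tcoeff_Umat_mult
  tcoeff_mult_Vmat tcoeff_Vmat_mult

lemma Fmat_inv_series [simp]: "Fmat_inv N h \<in> loop_series N"
  unfolding Fmat_inv_def by (rule loop_in_series[of 0]) simp

lemma tcoeff_Fmat_inv: "tcoeff N (Fmat_inv N h) p i = (if 0 \<le> p then h ^ nat p else 0)"
  unfolding Fmat_inv_def by (rule tcoeff_loop[of 0]) simp

lemma Fmat_mult_inv: "Fmat N h * Fmat_inv N h = 1\<^sub>m N"
  by (rule mat_mult_left_right_inverse[OF _ _ Fmat_inv_mult[OF N_pos]]) simp_all

section \<open>Truncation to negative degrees and sigma\<close>

lemma pi_minus_loop: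
  assumes "M \<in> loop_series N"
  shows "pi_minus N M \<in> loop_algebra N"
    and "tcoeff N (pi_minus N M) p i = (if p < 0 then tcoeff N M p i else 0)"
proof -
  obtain b where b: "\<forall>p<b. \<forall>i. tcoeff N M p i = 0"
    using loop_series_bound[OF assms] by blast
  let ?l = "\<lambda>p i. if p < 0 then lcoeff N M p i else 0"
  have l: "?l p i = 0" if "p < b" "i < N" for p i
    using b that by (simp add: lcoeff_eq_tcoeff)
  have c: "tcoeff N (pi_minus N M) p i = (if p < 0 then tcoeff N M p i else 0)" for p i
    unfolding pi_minus_def
    by (subst tcoeff_loop[OF l]) (simp_all add: lcoeff_eq_tcoeff)
  have "pi_minus N M \<in> loop_series N"
    unfolding pi_minus_def by (rule loop_in_series[OF l])
  then show "pi_minus N M \<in> loop_algebra N"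
    unfolding loop_algebra_iff using c by (auto intro!: exI[of _ 0])
  show "tcoeff N (pi_minus N M) p i = (if p < 0 then tcoeff N M p i else 0)" by (rule c)
qed

lemma sigma_eq: "sigma N h M = diag_Epow N (\<lambda>k. sigma_entry N h M (int k)) 0"
  unfolding sigma_def
  by (rule eq_matI) (auto simp: diag_Epow_def mat_diag_def sigma_entry_def lcoeff_eq_tcoeff)

lemma sigma_entry_mod: "sigma_entry N h M (i mod int N) = sigma_entry N h M i"
  by (simp add: sigma_entry_def)

text \<open>A summation range fixed by a degree bound is needed both for telescoping and for limits,
  because the support in the definition of \<open>sigma_entry\<close> may jump.\<close>

lemma sigma_entry_eq_sum:
  assumes "\<And>p. p < - int B \<Longrightarrow> tcoeff N M p i = 0"
  shows "sigma_entry N h M i = (\<Sum>m<B. h ^ Suc m * tcoeff N M (- int (Suc m)) i)"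
proof -
  have "sigma_entry N h M i = (\<Sum>p\<in>{- int B..<0}. h ^ nat (- p) * tcoeff N M p i)"
    unfolding sigma_entry_def
    by (rule sum.mono_neutral_left) (use assms in \<open>auto simp: not_less[symmetric]\<close>)
  also have "\<dots> = (\<Sum>m<B. h ^ Suc m * tcoeff N M (- int (Suc m)) i)"
    by (rule sum.reindex_bij_witness[of _ "\<lambda>m. - int (Suc m)" "\<lambda>p. nat (- p) - 1"])
       (auto simp: nat_diff_distrib)
  finally show ?thesis .
qed

lemmas loop_assoc = assoc_mult_mat[of _ N N _ N _ N]

lemma loop_series_one [simp]: "1\<^sub>m N \<in> loop_series N"
  by (simp add: one_eq_diag_Epow)

lemma loop_series_mult_one [simp]:
  assumes "M \<in> loop_series N"
  shows "M * 1\<^sub>m N = M" "1\<^sub>m N * M = M"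
  using right_mult_one_mat[of M N N] left_mult_one_mat[of M N N] assms by simp_all

lemma loop_mult_carrier [simp]:
  "A \<in> loop_series N \<Longrightarrow> B \<in> loop_series N \<Longrightarrow> A * B \<in> carrier_mat N N"
  by (rule loop_series_carrier) simp

subsection \<open>Inverses and covariance\<close>

text \<open>The entries lie in a field, so a trivial kernel gives some inverse K. What remains is
  that an inverse can be chosen twisted: filtering K by the grading filters \<open>M * K\<close>,
  and the identity passes that filter.\<close>

lemma loop_series_inverse:
  assumes M: "M \<in> loop_series N"
    and inj: "\<And>w. w \<in> carrier_vec N \<Longrightarrow> M *\<^sub>v w = 0\<^sub>v N \<Longrightarrow> w = 0\<^sub>v N"
  shows "\<exists>K\<in>loop_series N. M * K = 1\<^sub>m N \<and> K * M = 1\<^sub>m N"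
proof -
  have Mc: "M \<in> carrier_mat N N" using M by simp
  have "det M \<noteq> 0" using det_0_iff_vec_prod_zero_field[OF Mc] inj by blast
  from det_non_zero_imp_unit[OF Mc this, of "()"]
  obtain K where K: "K \<in> carrier_mat N N" "M * K = 1\<^sub>m N"
    by (auto simp: Units_def ring_mat_def)
  \<comment> \<open>the part of \<open>K\<close> that respects the twisting is already a right inverse\<close>
  define K' where "K' = mat N N (\<lambda>(i, j). Abs_fls (\<lambda>p.
    if int i mod int N = (int j + p) mod int N then fls_nth (K $$ (i, j)) p else 0))"
  have K'c: "K' \<in> carrier_mat N N" by (simp add: K'_def)
  have K': "fls_nth (K' $$ (i, j)) p =
      (if int i mod int N = (int j + p) mod int N then fls_nth (K $$ (i, j)) p else 0)"
    if "i < N" "j < N" for i j p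
  proof -
    have "fls_nth (Abs_fls (\<lambda>p. if int i mod int N = (int j + p) mod int N
        then fls_nth (K $$ (i, j)) p else 0)) p =
      (if int i mod int N = (int j + p) mod int N then fls_nth (K $$ (i, j)) p else 0)"
      by (subst nth_Abs_fls_lower_bound[of "fls_subdegree (K $$ (i, j))"]) auto
    then show ?thesis using that by (simp add: K'_def)
  qed
  have K's: "K' \<in> loop_series N"
    unfolding loop_series_iff using K' K'c by auto
  \<comment> \<open>A nonzero coefficient of M at (i, k) satisfies its own congruence, so p fits (i,
    j) iff the remaining degree \<open>p - q\<close> fits (k, j).\<close>
  have shift: "int i mod int N = (int j + p) mod int N \<longleftrightarrow>
      int k mod int N = (int j + (p - q)) mod int N"
    if "int i mod int N = (int k + q) mod int N" for i j k and p q :: int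
  proof -
    have "int N dvd int i - (int k + q)"
      using that by (simp only: mod_eq_dvd_iff)
    moreover have "int i - (int j + p) = (int i - (int k + q)) + (int k - (int j + (p - q)))"
      by simp
    ultimately show ?thesis
      unfolding mod_eq_dvd_iff by (simp only: dvd_add_right_iff)
  qed
  have "M * K' = 1\<^sub>m N"
  proof (rule eq_matI)
    fix i j assume "i < dim_row (1\<^sub>m N :: real fls mat)" "j < dim_col (1\<^sub>m N :: real fls mat)"
    then have ij: "i < N" "j < N" by auto
    have Mq: "int i mod int N = (int k + q) mod int N"
      if "fls_nth (M $$ (i, k)) q \<noteq> 0" "k < N" for k q
      using M that ij unfolding loop_series_iff by blast
    show "(M * K') $$ (i, j) = (1\<^sub>m N :: real fls mat) $$ (i, j)"
    proof (rule fls_eqI)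
      fix p
      have "fls_nth ((M * K') $$ (i, j)) p = (\<Sum>k<N. fls_nth (M $$ (i, k) * K' $$ (k, j)) p)"
        by (simp only: mult_mat_index_sum[OF Mc K'c ij] fls_nth_sum)
      also have "\<dots> = (\<Sum>k<N. if int i mod int N = (int j + p) mod int N
          then fls_nth (M $$ (i, k) * K $$ (k, j)) p else 0)"
      proof (rule sum.cong[OF refl])
        fix k assume "k \<in> {..<N}"
        then have k: "k < N" by simp
        show "fls_nth (M $$ (i, k) * K' $$ (k, j)) p = (if int i mod int N = (int j + p) mod int N
            then fls_nth (M $$ (i, k) * K $$ (k, j)) p else 0)"
        proof (cases "int i mod int N = (int j + p) mod int N")
          case True
          \<comment> \<open>The difference has only misfitting degrees, and M cannot complete such a
            degree to a fitting p.\<close>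
          have "fls_nth (M $$ (i, k) * (K $$ (k, j) - K' $$ (k, j))) p = 0"
          proof (rule ccontr)
            assume "\<not> ?thesis"
            then obtain q where q: "fls_nth (M $$ (i, k)) q \<noteq> 0"
                "fls_nth (K $$ (k, j) - K' $$ (k, j)) (p - q) \<noteq> 0"
              using fls_times_nth_nonzeroD by blast
            have "int k mod int N = (int j + (p - q)) mod int N"
              using shift[OF Mq[OF q(1) k], of j p] True by blast
            then have "fls_nth (K' $$ (k, j)) (p - q) = fls_nth (K $$ (k, j)) (p - q)"
              by (rule trans[OF K'[OF k ij(2)] if_P])
            then show False using q(2) by simp
          qed
          then have "fls_nth (M $$ (i, k) * K $$ (k, j)) p = fls_nth (M $$ (i, k) * K' $$ (k, j)) p"
            by (simp add: right_diff_distrib)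
          then show ?thesis using True by simp
        next
          case False
          have "fls_nth (M $$ (i, k) * K' $$ (k, j)) p = 0"
          proof (rule ccontr)
            assume "\<not> ?thesis"
            then obtain q where q: "fls_nth (M $$ (i, k)) q \<noteq> 0" "fls_nth (K' $$ (k, j)) (p - q) \<noteq> 0"
              using fls_times_nth_nonzeroD by blast
            have "\<not> int k mod int N = (int j + (p - q)) mod int N"
              using shift[OF Mq[OF q(1) k], of j p] False by blast
            then show False using q(2) by (simp only: K'[OF k ij(2)] if_False simp_thms)
          qed
          then show ?thesis using False by simp
        qed
      qed
      also have "\<dots> = (if int i mod int N = (int j + p) mod int N
          then fls_nth ((M * K) $$ (i, j)) p else 0)"
        by (simp only: mult_mat_index_sum[OF Mc K(1) ij] fls_nth_sum) simp
      \<comment> \<open>The identity lives in degree 0 on the diagonal, where the congruence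
        holds.\<close>
      also have "\<dots> = fls_nth ((1\<^sub>m N :: real fls mat) $$ (i, j)) p"
        unfolding K(2) using ij by auto
      finally show "fls_nth ((M * K') $$ (i, j)) p = fls_nth ((1\<^sub>m N :: real fls mat) $$ (i, j)) p" .
    qed
  qed (use Mc K'c in auto)
  then show ?thesis
    using K's mat_mult_left_right_inverse[OF Mc K'c] by blast
qed

lemma diag_Epow_mult_vec:
  assumes "w \<in> carrier_vec N" "k < N"
  shows "(diag_Epow N d q *\<^sub>v w) $ k = fls_const (d k) * fls_X_intpow q * w $ (res N (int k - q))"
proof -
  define m where "m = res N (int k - q)"
  have "(diag_Epow N d q *\<^sub>v w) $ k = (\<Sum>j<N. diag_Epow N d q $$ (k, j) * w $ j)"
    using assms carrier_matD[OF diag_Epow_carrier[of N d q]]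
    by (simp add: scalar_prod_def lessThan_atLeast0)
  also have "\<dots> = (\<Sum>j<N. if j = m then fls_const (d k) * fls_X_intpow q * w $ m else 0)"
  proof (rule sum.cong[OF refl])
    fix j assume j: "j \<in> {..<N}"
    have "int k mod int N = (int j + q) mod int N \<longleftrightarrow> j = m"
      using j res_diff_eq[of k j q] by (auto simp: m_def mod_simps)
    then show "diag_Epow N d q $$ (k, j) * w $ j =
        (if j = m then fls_const (d k) * fls_X_intpow q * w $ m else 0)"
      using j assms by (simp add: diag_Epow_def)
  qed
  also have "\<dots> = fls_const (d k) * fls_X_intpow q * w $ m" by (simp add: m_def)
  finally show ?thesis by (simp add: m_def)
qed

text \<open>A kernel vector satisfies w(k) = - v(k) \<lambda>^(-1) w(k + 1), so a nonzero component
  forces its successor to be nonzero with subdegree one higher.\<close>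

lemma Vmat_inverse: "\<exists>K\<in>loop_series N. Vmat N v * K = 1\<^sub>m N \<and> K * Vmat N v = 1\<^sub>m N"
proof (rule loop_series_inverse)
  fix w assume w: "w \<in> carrier_vec N" and V: "Vmat N v *\<^sub>v w = 0\<^sub>v N"
  show "w = 0\<^sub>v N"
  proof (rule fls_vec_eq_0I[OF w])
    fix k assume k: "k < N" "w $ k \<noteq> 0"
    define m where "m = res N (int k + 1)"
    have "(Vmat N v *\<^sub>v w) $ k = (diag_Epow N (\<lambda>_. 1) 0 *\<^sub>v w) $ k + (diag_Epow N v (- 1) *\<^sub>v w) $ k"
      using w k by (simp add: Vmat_eq add_mult_distrib_mat_vec[OF diag_Epow_carrier diag_Epow_carrier w]
          carrier_matD[OF diag_Epow_carrier])
    then have "w $ k + fls_const (v k) * fls_X_intpow (- 1) * w $ m = 0"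
      using V w k by (simp add: diag_Epow_mult_vec m_def del: fls_shift_fls_shift)
    then have e: "w $ k = fls_const (- v k) * (fls_X_intpow (- 1) * w $ m)"
      by (simp add: eq_neg_iff_add_eq_0 mult.assoc)
    then have wm: "w $ m \<noteq> 0" using k by auto
    have "v k \<noteq> 0" using e k by auto
    moreover have "fls_subdegree (fls_X_intpow (- 1) * w $ m) = fls_subdegree (w $ m) - 1"
      using fls_subdegree_mult_fls_X_intpow(1)[OF wm, of "- 1"] by simp
    moreover have "fls_X_intpow (- 1) * w $ m \<noteq> 0" using e k by auto
    ultimately have "fls_subdegree (w $ k) = fls_subdegree (w $ m) - 1"
      unfolding e by (subst fls_subdegree_mult) auto
    then show "\<exists>m<N. w $ m \<noteq> 0 \<and> fls_subdegree (w $ k) < fls_subdegree (w $ m)"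
      using wm by (intro exI[of _ m]) (simp add: m_def)
  qed
qed simp

text \<open>Row k + 1 of the kernel equation is \<lambda> w(k) = - u(k + 1) w(k + 1); again the
  subdegree rises by one around the cycle, which is impossible.\<close>

lemma Umat_inverse: "\<exists>K\<in>loop_series N. Umat N u * K = 1\<^sub>m N \<and> K * Umat N u = 1\<^sub>m N"
proof (rule loop_series_inverse)
  fix w assume w: "w \<in> carrier_vec N" and U: "Umat N u *\<^sub>v w = 0\<^sub>v N"
  show "w = 0\<^sub>v N"
  proof (rule fls_vec_eq_0I[OF w])
    fix k assume k: "k < N" "w $ k \<noteq> 0"
    define m where "m = res N (int k + 1)"
    have m: "m < N" by (simp add: m_def)
    have km: "res N (int m - 1) = k"
      using k by (simp add: m_def)
    have "(Umat N u *\<^sub>v w) $ m = (diag_Epow N u 0 *\<^sub>v w) $ m + (diag_Epow N (\<lambda>_. 1) 1 *\<^sub>v w) $ m"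
      using w m by (simp add: Umat_eq add_mult_distrib_mat_vec[OF diag_Epow_carrier diag_Epow_carrier w]
          carrier_matD[OF diag_Epow_carrier])
    then have "fls_const (u m) * w $ m + fls_X_intpow 1 * w $ k = 0"
      using U w m by (simp add: diag_Epow_mult_vec km del: fls_shift_fls_shift)
    then have e: "fls_X_intpow 1 * w $ k = fls_const (- u m) * w $ m"
      by (simp add: eq_neg_iff_add_eq_0 add.commute)
    have nz: "fls_X_intpow 1 * w $ k \<noteq> 0" using k by simp
    then have um: "w $ m \<noteq> 0" "u m \<noteq> 0" using e by auto
    have "fls_subdegree (fls_X_intpow 1 * w $ k) = fls_subdegree (w $ k) + 1"
      using k by (simp add: fls_X_intpow_times_conv_shift)
    then have "fls_subdegree (w $ m) = fls_subdegree (w $ k) + 1"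
      using um by (simp add: e)
    then show "\<exists>m<N. w $ m \<noteq> 0 \<and> fls_subdegree (w $ k) < fls_subdegree (w $ m)"
      using m um by (intro exI[of _ m]) simp
  qed
qed simp

text \<open>\<open>A * B\<close> is the conjugate of \<open>B * A\<close> by A.\<close>

lemma conj_covariant_swap:
  assumes f: "conj_covariant N f" and A: "A \<in> loop_series N" and B: "B \<in> loop_series N"
    and inv: "\<exists>K\<in>loop_series N. A * K = 1\<^sub>m N \<and> K * A = 1\<^sub>m N"
  shows "f (A * B) * A = A * f (B * A)"
proof -
  obtain K where K: "K \<in> loop_series N" "A * K = 1\<^sub>m N" "K * A = 1\<^sub>m N"
    using inv by blast
  have fBA: "f (B * A) \<in> loop_series N"
    using f A B by (auto simp: conj_covariant_def)
  have "A * (B * A) * K = A * B"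
    using A B K by (simp add: loop_assoc)
  moreover have "f (A * (B * A) * K) = A * f (B * A) * K"
    using f K loop_series_mult[OF B A] A unfolding conj_covariant_def by blast
  ultimately have "f (A * B) = A * f (B * A) * K" by simp
  then show ?thesis
    using A K fBA by (simp add: loop_assoc)
qed

lemma Lplus_series [simp]: "Lplus N h u v \<in> loop_series N"
  by (simp add: Lplus_def)

lemma triad_intertwine:
  fixes u v :: "nat \<Rightarrow> real" and h :: real and f :: "real fls mat \<Rightarrow> real fls mat"
  assumes f: "conj_covariant N f"
  defines "T0 \<equiv> f (Lplus N h u v)"
    and "T1 \<equiv> f (Umat N u * Vmat N v * Fmat_inv N h)"
    and "T2 \<equiv> f (Vmat N v * Fmat_inv N h * Umat N u)"
  shows "T0 \<in> loop_series N" "T1 \<in> loop_series N" "T2 \<in> loop_series N"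
    and "T1 * Fmat N h = Fmat N h * T0" "T1 * Umat N u = Umat N u * T2"
    and "T2 * Vmat N v = Vmat N v * T0"
proof -
  let ?U = "Umat N u" and ?V = "Vmat N v" and ?F = "Fmat N h" and ?G = "Fmat_inv N h"
  show "T0 \<in> loop_series N" "T1 \<in> loop_series N" "T2 \<in> loop_series N"
    using f by (auto simp: conj_covariant_def T0_def T1_def T2_def)
  have GF: "?G * ?F = 1\<^sub>m N" and FG: "?F * ?G = 1\<^sub>m N"
    using Fmat_inv_mult[OF N_pos] Fmat_mult_inv by auto
  \<comment> \<open>The second factor is chosen so that the products in the two orders reduce to
    \<open>?U * ?V * ?G\<close> and \<open>?G * ?U * ?V\<close>.\<close>
  have "f (?F * (?G * ?U * ?V * ?G)) * ?F = ?F * f (?G * ?U * ?V * ?G * ?F)"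
    by (rule conj_covariant_swap[OF f]) (use GF FG in \<open>auto intro: Fmat_inv_series\<close>)
  moreover have "?F * (?G * ?U * ?V * ?G) = ?F * ?G * (?U * ?V * ?G)"
    "?G * ?U * ?V * ?G * ?F = ?G * ?U * ?V * (?G * ?F)"
    by (simp_all add: loop_assoc)
  ultimately show "T1 * ?F = ?F * T0"
    by (simp add: GF FG T1_def T0_def Lplus_def)
  have "f (?U * (?V * ?G)) * ?U = ?U * f (?V * ?G * ?U)"
    by (rule conj_covariant_swap[OF f _ _ Umat_inverse]) auto
  then show "T1 * ?U = ?U * T2"
    by (simp add: T1_def T2_def loop_assoc)
  have "f (?V * (?G * ?U)) * ?V = ?V * f (?G * ?U * ?V)"
    by (rule conj_covariant_swap[OF f _ _ Vmat_inverse]) auto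
  then show "T2 * ?V = ?V * T0"
    by (simp add: T2_def T0_def Lplus_def loop_assoc)
qed

text \<open>
  In degree \<open>p\<close> the hypothesis reads \<open>t1 p i - h t1 (p - 1) i = t0 p i - h t0 (p - 1) (i - 1)\<close>;
  weighted with \<open>h ^ (- p)\<close> and summed over \<open>p < 0\<close>, both sides telescope.
\<close>

lemma sigma_entry_intertwine:
  assumes T: "T0 \<in> loop_series N" "T1 \<in> loop_series N" and e: "T1 * Fmat N h = Fmat N h * T0"
  shows "sigma_entry N h T0 i - sigma_entry N h T0 (i - 1) =
    h * (tcoeff N T1 (- 1) i - tcoeff N T0 (- 1) (i - 1))"
proof -
  obtain b0 b1 where b: "\<forall>p<b0. \<forall>i. tcoeff N T0 p i = 0" "\<forall>p<b1. \<forall>i. tcoeff N T1 p i = 0"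
    using loop_series_bound[of T0] loop_series_bound[of T1] T by auto
  \<comment> \<open>One depth for both matrices: neither has coefficients below degree -B.\<close>
  define B where "B = nat (- b0) + nat (- b1)"
  have "- int B \<le> b0" "- int B \<le> b1" by (simp_all add: B_def)
  then have B: "tcoeff N T0 p i = 0" "tcoeff N T1 p i = 0" if "p < - int B" for p i
    using b that by auto
  have sigma_entry: "sigma_entry N h T i = (\<Sum>m<B. h ^ Suc m * tcoeff N T (- int (Suc m)) i)"
    if "T = T0 \<or> T = T1" for T i
    by (rule sigma_entry_eq_sum) (use B that in auto)
  \<comment> \<open>The index shift drops the term of degree -1; the term gained at the other end
    has degree -(B + 1) and vanishes.\<close>
  have split: "(\<Sum>m<B. h ^ Suc (Suc m) * tcoeff N T (- int (Suc (Suc m))) i) =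
      sigma_entry N h T i - h * tcoeff N T (- 1) i" if "T = T0 \<or> T = T1" for T i
  proof -
    let ?g = "\<lambda>m. h ^ Suc m * tcoeff N T (- int (Suc m)) i"
    have "(\<Sum>m<B. ?g (Suc m)) = (\<Sum>m<B. ?g m) + ?g B - ?g 0"
      using sum.lessThan_Suc_shift[of ?g B] sum.lessThan_Suc[of ?g B] by linarith
    moreover have "?g B = 0" using B that by auto
    ultimately show ?thesis using sigma_entry[OF that, of i] by simp
  qed
  have rel: "h ^ Suc m * tcoeff N T1 (- int (Suc m)) i
      - h ^ Suc (Suc m) * tcoeff N T1 (- int (Suc (Suc m))) i =
      h ^ Suc m * tcoeff N T0 (- int (Suc m)) i
      - h ^ Suc (Suc m) * tcoeff N T0 (- int (Suc (Suc m))) (i - 1)" for m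
  proof -
    have "tcoeff N T1 (- int (Suc m)) i - h * tcoeff N T1 (- int (Suc m) - 1) i =
        tcoeff N T0 (- int (Suc m)) i - h * tcoeff N T0 (- int (Suc m) - 1) (i - 1)"
      using arg_cong[OF e, of "\<lambda>M. tcoeff N M (- int (Suc m)) i"] T
      by (simp only: tcoeff_mult_Fmat tcoeff_Fmat_mult loop_series_carrier)
    then have "h ^ Suc m * (tcoeff N T1 (- int (Suc m)) i - h * tcoeff N T1 (- int (Suc m) - 1) i) =
        h ^ Suc m * (tcoeff N T0 (- int (Suc m)) i - h * tcoeff N T0 (- int (Suc m) - 1) (i - 1))"
      by simp
    moreover have "- int (Suc m) - 1 = - int (Suc (Suc m))" by simp
    ultimately show ?thesis by (simp only: right_diff_distrib power_Suc mult_ac)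
  qed
  have "(\<Sum>m<B. h ^ Suc m * tcoeff N T1 (- int (Suc m)) i
      - h ^ Suc (Suc m) * tcoeff N T1 (- int (Suc (Suc m))) i) = (\<Sum>m<B.       h ^ Suc m * tcoeff N T0 (- int (Suc m)) i
      - h ^ Suc (Suc m) * tcoeff N T0 (- int (Suc (Suc m))) (i - 1))"
    by (rule sum.cong[OF refl rel])
  \<comment> \<open>The contributions of sigma(T1) cancel, leaving only its boundary term in degree
    -1.\<close>
  then have "sigma_entry N h T1 i - (sigma_entry N h T1 i - h * tcoeff N T1 (- 1) i) =
      sigma_entry N h T0 i - (sigma_entry N h T0 (i - 1) - h * tcoeff N T0 (- 1) (i - 1))"
    by (simp only: sum_subtractf split simp_thms sigma_entry[symmetric])
  then show ?thesis by (simp add: algebra_simps)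
qed

lemma A0_eq:
  "A0 N h f u v = pi_minus N (f (Lplus N h u v))
     - diag_Epow N (\<lambda>k. sigma_entry N h (f (Lplus N h u v)) (int k)) 0"
  by (simp add: A0_def sigma_eq)

text \<open>The common shape of A0, A1 and A2: an exact copy of M in negative degrees, a prescribed
  diagonal, and nothing above.\<close>

lemma pi_minus_diag:
  assumes "M \<in> loop_series N"
  shows "pi_minus N M - diag_Epow N d 0 \<in> loop_algebra N"
    and "tcoeff N (pi_minus N M - diag_Epow N d 0) p i =
      (if p < 0 then tcoeff N M p i else if p = 0 then - d (res N i) else 0)"
proof -
  note t = pi_minus_loop[OF assms]
  show c: "tcoeff N (pi_minus N M - diag_Epow N d 0) p i =
      (if p < 0 then tcoeff N M p i else if p = 0 then - d (res N i) else 0)" for p i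
    using t by (simp add: tcoeff_diag_Epow)
  show "pi_minus N M - diag_Epow N d 0 \<in> loop_algebra N"
    unfolding loop_algebra_iff using c t(1) by (auto intro!: exI[of _ 0])
qed

subsection \<open>Existence and uniqueness of the triad\<close>

text \<open>The velocities are read off in degrees 0 and -1; the content is that the two expressions
  vanish in all other degrees.\<close>

lemma triad_exists:
  fixes u v :: "nat \<Rightarrow> real" and h :: real and f :: "real fls mat \<Rightarrow> real fls mat"
  assumes f: "conj_covariant N f"
  defines "B0 \<equiv> A0 N h f u v" and "B1 \<equiv> triad_A1 N h f u v" and "B2 \<equiv> triad_A2 N h f u v"
  shows "triad N h f u v B1 B2
    (\<lambda>k. tcoeff N (B1 * Umat N u - Umat N u * B2) 0 (int k))
    (\<lambda>k. tcoeff N (B2 * Vmat N v - Vmat N v * B0) (- 1) (int k))"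
proof -
  define T0 where "T0 = f (Lplus N h u v)"
  define T1 where "T1 = f (Umat N u * Vmat N v * Fmat_inv N h)"
  define T2 where "T2 = f (Vmat N v * Fmat_inv N h * Umat N u)"
  note T = triad_intertwine[OF f, where h = h and u = u and v = v, folded T0_def T1_def T2_def]
  have B_alg [simp]: "B0 \<in> loop_algebra N" "B1 \<in> loop_algebra N" "B2 \<in> loop_algebra N"
    using pi_minus_diag(1) T(1-3)
    by (simp_all add: B0_def B1_def B2_def A0_eq triad_A1_def triad_A2_def T0_def T1_def T2_def)
  define s where "s = sigma_entry N h T0"
  \<comment> \<open>The diagonals are evaluated at reduced indices, so s must not depend on the
    representative.\<close>
  have s_mod [simp]: "s (i mod int N) = s i" "s (i mod int N - 1) = s (i - 1)" for i
    using sigma_entry_mod[of h T0] sigma_entry_mod[of h T0 "i mod int N - 1"]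
      sigma_entry_mod[of h T0 "i - 1"] by (simp_all add: s_def mod_diff_left_eq)
  have c0: "tcoeff N B0 p i = (if p < 0 then tcoeff N T0 p i else if p = 0 then - s i else 0)" for p i
    unfolding B0_def A0_eq T0_def[symmetric] s_def[symmetric]
    by (subst pi_minus_diag(2)[OF T(1)]) simp
  have c1: "tcoeff N B1 p i = (if p < 0 then tcoeff N T1 p i else if p = 0 then - s (i - 1) else 0)" for p i
    unfolding B1_def triad_A1_def T1_def[symmetric] T0_def[symmetric] s_def[symmetric]
    by (subst pi_minus_diag(2)[OF T(2)]) simp
  have c2: "tcoeff N B2 p i = (if p < 0 then tcoeff N T2 p i else if p = 0 then - s i else 0)" for p i
    unfolding B2_def triad_A2_def T2_def[symmetric] T0_def[symmetric] s_def[symmetric]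
    by (subst pi_minus_diag(2)[OF T(3)]) simp
  have relF: "tcoeff N T1 p i - h * tcoeff N T1 (p - 1) i =
      tcoeff N T0 p i - h * tcoeff N T0 (p - 1) (i - 1)" for p i
    using arg_cong[OF T(4), of "\<lambda>M. tcoeff N M p i"] T(1,2) by (simp add: two_term)
  have relU: "tcoeff N T1 p i * u (res N (i - p)) + tcoeff N T1 (p - 1) i =
      u (res N i) * tcoeff N T2 p i + tcoeff N T2 (p - 1) (i - 1)" for p i
    using arg_cong[OF T(5), of "\<lambda>M. tcoeff N M p i"] T(2,3) by (simp add: two_term)
  have relV: "tcoeff N T2 p i + tcoeff N T2 (p + 1) i * v (res N (i - (p + 1))) =
      tcoeff N T0 p i + v (res N i) * tcoeff N T0 (p + 1) (i + 1)" for p i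
    using arg_cong[OF T(6), of "\<lambda>M. tcoeff N M p i"] T(1,3) by (simp add: two_term)
  have s: "s i - s (i - 1) = h * (tcoeff N T1 (- 1) i - tcoeff N T0 (- 1) (i - 1))" for i
    unfolding s_def by (rule sigma_entry_intertwine[OF T(1,2,4)])
  have F: "B1 * Fmat N h = Fmat N h * B0"
  proof (rule loop_series_eqI)
    fix p i :: int
    \<comment> \<open>Degree p involves only coefficients of degrees p and p - 1. Below 0 the
      truncation is therefore invisible, degree 0 is the telescoped identity \<open>s\<close>, and
      in degree 1 the shifted diagonals agree.\<close>
    consider "p < 0" | "p = 0" | "p = 1" | "p > 1" by linarith
    then show "tcoeff N (B1 * Fmat N h) p i = tcoeff N (Fmat N h * B0) p i"
    proof cases
      case 1
      then show ?thesis using relF[of p i] by (simp add: two_term c0 c1)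
    next
      case 2
      then show ?thesis using s[of i] by (simp add: two_term c0 c1 algebra_simps)
    qed (simp_all add: two_term c0 c1)
  qed simp_all
  have U: "B1 * Umat N u - Umat N u * B2 =
      diag_Epow N (\<lambda>k. tcoeff N (B1 * Umat N u - Umat N u * B2) 0 (int k)) 0" (is "?X = _")
  proof (rule loop_series_eqI)
    fix p i :: int
    \<comment> \<open>In degree 1 both products give - s(i - 1); degree 0 carries the velocity of
      u.\<close>
    consider "p < 0" | "p = 0" | "p = 1" | "p > 1" by linarith
    then show "tcoeff N ?X p i = tcoeff N (diag_Epow N (\<lambda>k. tcoeff N ?X 0 (int k)) 0) p i"
    proof cases
      case 1
      then show ?thesis using relU[of p i] by (simp add: two_term tcoeff_diag_Epow c1 c2)
    next
      case 2
      then show ?thesis by (simp only: tcoeff_diag_Epow int_res tcoeff_mod simp_thms if_True)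
    qed (simp_all add: two_term tcoeff_diag_Epow c1 c2)
  qed simp_all
  have V: "B2 * Vmat N v - Vmat N v * B0 =
      diag_Epow N (\<lambda>k. tcoeff N (B2 * Vmat N v - Vmat N v * B0) (- 1) (int k)) (- 1)" (is "?X = _")
  proof (rule loop_series_eqI)
    fix p i :: int
    \<comment> \<open>V reaches up to degree p + 1, so the truncation is invisible only below -1. In
      degree 0 the equal diagonals of A2 and A0 cancel.\<close>
    consider "p < - 1" | "p = - 1" | "p = 0" | "p > 0" by linarith
    then show "tcoeff N ?X p i = tcoeff N (diag_Epow N (\<lambda>k. tcoeff N ?X (- 1) (int k)) (- 1)) p i"
    proof cases
      case 1
      then show ?thesis using relV[of p i] by (simp add: two_term tcoeff_diag_Epow c0 c2)
    next
      case 2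
      then show ?thesis by (simp only: tcoeff_diag_Epow int_res tcoeff_mod simp_thms if_True)
    qed (simp_all add: two_term tcoeff_diag_Epow c0 c2)
  qed simp_all
  show ?thesis
    unfolding triad_def diag_Epow_0 diag_Epow_minus_1
    using B_alg F U V unfolding B0_def by blast
qed

lemma compatible_A1_unique:
  assumes "compatible N h f u v A1 A2" "compatible N h f u v B1 B2"
  shows "A1 = B1"
proof -
  have e: "A1 * Fmat N h = B1 * Fmat N h" and AB: "A1 \<in> loop_series N" "B1 \<in> loop_series N"
    using assms by (auto simp: compatible_def triad_def)
  have "A1 * Fmat N h * Fmat_inv N h = B1 * Fmat N h * Fmat_inv N h"
    by (simp only: e)
  then show ?thesis
    using AB by (simp add: loop_assoc Fmat_mult_inv)
qed

text \<open>With A1 shared, the difference d of the candidates satisfies a homogeneous recursion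
  from U and one from V. Nonnegative degrees are cleared downwards from the upper bound; negative
  ones are cleared upwards from the lower bound, dividing by u or by v.\<close>

lemma compatible_A2_unique:
  assumes A: "compatible N h f u v A1 A2" and B: "compatible N h f u v B1 B2"
    and nz: "(\<forall>k<N. u k \<noteq> 0) \<or> (\<forall>k<N. v k \<noteq> 0)"
  shows "A2 = B2"
proof -
  have AB1: "A1 = B1" by (rule compatible_A1_unique[OF A B])
  define d where "d p i = tcoeff N A2 p i - tcoeff N B2 p i" for p i
  obtain ua va ub vb where tA: "triad N h f u v A1 A2 ua va" and tB: "triad N h f u v A1 B2 ub vb"
    using A B AB1 by (auto simp: compatible_def)
  have alg [simp]: "A1 \<in> loop_algebra N" "A2 \<in> loop_algebra N" "B2 \<in> loop_algebra N"
    using tA tB by (auto simp: triad_def)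
  \<comment> \<open>Degree 0 is excluded because the two candidates may define different velocities
    of u; \<open>relV\<close> excludes -1 likewise for v.\<close>
  have relU: "u (res N i) * d p i + d (p - 1) (i - 1) = 0" if "p \<noteq> 0" for p i
  proof -
    have "tcoeff N (A1 * Umat N u - Umat N u * A2) p i = 0"
      "tcoeff N (A1 * Umat N u - Umat N u * B2) p i = 0"
      using tA tB that unfolding triad_def diag_Epow_0 by (simp_all only: tcoeff_diag_Epow if_False)
    then show ?thesis
      by (simp add: tcoeff_Umat_mult d_def algebra_simps)
  qed
  have relV: "d p i + d (p + 1) i * v (res N (i - (p + 1))) = 0" if "p \<noteq> - 1" for p i
  proof -
    \<comment> \<open>The dimensions of a difference are those of its second term, here the diagonal
      sigma.\<close>
    have "A0 N h f u v \<in> carrier_mat N N"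
      unfolding A0_def sigma_eq by (rule minus_carrier_mat) simp
    then have *: "Vmat N v * A0 N h f u v \<in> carrier_mat N N"
      by (intro mult_carrier_mat[of _ N N]) simp_all
    have "tcoeff N (A2 * Vmat N v - Vmat N v * A0 N h f u v) p i = 0"
      "tcoeff N (B2 * Vmat N v - Vmat N v * A0 N h f u v) p i = 0"
      using tA tB that unfolding triad_def diag_Epow_minus_1 by (simp_all only: tcoeff_diag_Epow if_False)
    then show ?thesis
      using * by (simp add: tcoeff_mult_Vmat d_def algebra_simps)
  qed
  obtain b b' where b: "\<forall>p>b. \<forall>i. tcoeff N A2 p i = 0" "\<forall>p>b'. \<forall>i. tcoeff N B2 p i = 0"
    using alg(2,3) unfolding loop_algebra_iff by blast
  obtain a a' where a: "\<forall>p<a. \<forall>i. tcoeff N A2 p i = 0" "\<forall>p<a'. \<forall>i. tcoeff N B2 p i = 0"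
    using loop_series_bound[of A2] loop_series_bound[of B2] alg by auto
  have pos: "\<forall>i. d p i = 0" if "p > - 1" for p
  proof (rule int_descend[of "max b b'" "\<lambda>p. \<forall>i. d p i = 0" "- 1"])
    show "\<forall>p>max b b'. \<forall>i. d p i = 0" using b by (simp add: d_def)
    show "\<forall>i. d p i = 0" if "p > - 1" "\<forall>i. d (p + 1) i = 0" for p
      using relV[of p] that by simp
  qed (use that in simp)
  have start: "\<forall>p<min a a'. \<forall>i. d p i = 0" using a by (simp add: d_def)
  have neg: "\<forall>i. d p i = 0" if "p < 0" for p
    using nz
  proof
    assume u: "\<forall>k<N. u k \<noteq> 0"
    show ?thesis
    proof (rule int_ascend[OF start, of 0])
      show "\<forall>i. d p i = 0" if "p < 0" "\<forall>i. d (p - 1) i = 0" for p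
        using relU[of p] that u by auto
    qed (use that in simp)
  next
    assume v: "\<forall>k<N. v k \<noteq> 0"
    show ?thesis
    proof (rule int_ascend[OF start, of 0])
      \<comment> \<open>For negative p the relation at \<open>p - 1\<close> stays below the excluded
        degree -1 and gives v d(p) = 0 at the relevant index.\<close>
      show "\<forall>i. d p i = 0" if "p < 0" "\<forall>i. d (p - 1) i = 0" for p
        using relV[of "p - 1"] that v by auto
    qed (use that in simp)
  qed
  have "d p i = 0" for p i
    using pos[of p] neg[of p] by (cases "p < 0") auto
  then show ?thesis
    by (intro loop_series_eqI) (simp_all add: d_def)
qed

subsection \<open>Continuous fields\<close>

lemma coeffs_continuousI:
  assumes "\<And>w. X w \<in> loop_series N"
    and "\<And>p i. continuous_on UNIV (\<lambda>w. tcoeff N (X w) p i)"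
  shows "coeffs_continuous N X"
  unfolding coeffs_continuous_def
proof (intro allI impI)
  fix i j p assume "i < N" "j < N"
  then show "continuous_on UNIV (\<lambda>w. fls_nth (X w $$ (i, j)) p)"
    using assms(2) by (simp only: loop_series_nth[OF assms(1)]) (intro continuous_intros)
qed

lemma coeffs_continuousD:
  "coeffs_continuous N X \<Longrightarrow> continuous_on UNIV (\<lambda>w. tcoeff N (X w) p i)"
  by (simp add: coeffs_continuous_def tcoeff_def)

lemma compatible_algebra:
  assumes "compatible N h f u v A1 A2"
  shows "A1 \<in> loop_algebra N" "A2 \<in> loop_algebra N"
  using assms by (auto simp: compatible_def triad_def)

lemma compatible_field_unique:
  assumes A: "compatible_field N h f A" and B: "compatible_field N h f B"
  shows "A = B"
proof (rule ext)
  fix w :: "(nat \<Rightarrow> real) \<times> (nat \<Rightarrow> real)"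
  obtain u v where w: "w = (u, v)" by (cases w)
  have cA: "compatible N h f u v (fst (A (u, v))) (snd (A (u, v)))" for u v
    using A by (simp add: compatible_field_def)
  have cB: "compatible N h f u v (fst (B (u, v))) (snd (B (u, v)))" for u v
    using B by (simp add: compatible_field_def)
  have 1: "fst (A w) = fst (B w)"
    unfolding w by (rule compatible_A1_unique[OF cA cB])
  have 2: "snd (A w) = snd (B w)"
  proof (rule loop_series_eqI)
    show "snd (A w) \<in> loop_series N" "snd (B w) \<in> loop_series N"
      unfolding w using compatible_algebra[OF cA] compatible_algebra[OF cB] by simp_all
    fix p i
    \<comment> \<open>no \<open>u k + e\<close> vanishes for small \<open>e \<noteq> 0\<close>, where \<open>A2\<close> is unique pointwise\<close>
    define c where "c e = ((\<lambda>k. u k + e), v)" for e :: real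
    define g where "g e = tcoeff N (snd (A (c e))) p i - tcoeff N (snd (B (c e))) p i" for e
    have "continuous_on UNIV c"
      unfolding c_def by (intro continuous_on_Pair continuous_on_coordinatewise_then_product continuous_intros)
    moreover have "continuous_on UNIV (\<lambda>w. tcoeff N (snd (A w)) p i)"
      "continuous_on UNIV (\<lambda>w. tcoeff N (snd (B w)) p i)"
      using A B coeffs_continuousD[of "snd \<circ> A"] coeffs_continuousD[of "snd \<circ> B"]
      by (simp_all add: compatible_field_def)
    ultimately have "continuous_on UNIV (\<lambda>e. tcoeff N (snd (A (c e))) p i)"
      "continuous_on UNIV (\<lambda>e. tcoeff N (snd (B (c e))) p i)"
      using continuous_on_compose2[of UNIV _ UNIV c] by auto
    then have "continuous_on UNIV g"
      unfolding g_def by (rule continuous_on_diff)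
    then have lim: "(g \<longlongrightarrow> g 0) (at 0)"
      by (simp add: continuous_on_def)
    \<comment> \<open>The neighbourhood is punctured at 0, so this covers \<open>u k = 0\<close> as
      well.\<close>
    have "eventually (\<lambda>e. e \<noteq> - u k) (at (0 :: real))" for k
      by (rule eventually_neq_at_within)
    then have "eventually (\<lambda>e. \<forall>k\<in>{..<N}. e \<noteq> - u k) (at 0)"
      by (intro eventually_ball_finite) auto
    then have "eventually (\<lambda>e. g e = 0) (at 0)"
    proof (rule eventually_mono)
      fix e assume "\<forall>k\<in>{..<N}. e \<noteq> - u k"
      then have "\<forall>k<N. u k + e \<noteq> 0" by (auto simp: add_eq_0_iff)
      then have "snd (A (c e)) = snd (B (c e))"
        unfolding c_def by (intro compatible_A2_unique[OF cA cB]) simp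
      then show "g e = 0" by (simp add: g_def)
    qed
    then have "(g \<longlongrightarrow> 0) (at 0)"
      by (rule tendsto_eventually)
    then have "g 0 = 0" using lim LIM_unique by blast
    then show "tcoeff N (snd (A w)) p i = tcoeff N (snd (B w)) p i"
      by (simp add: g_def c_def w)
  qed
  show "A w = B w" using 1 2 by (rule prod_eqI)
qed

text \<open>Convergence in the completed algebra is sequential, so continuity is tested along
  sequences in a first countable domain; the uniform bound b turns coefficientwise convergence into
  \<open>loop_tendsto\<close>.\<close>

lemma loop_continuous_compose:
  fixes X :: "'a::{first_countable_topology, t2_space} \<Rightarrow> real fls mat"
  assumes f: "loop_continuous N f" and fs: "f ` loop_series N \<subseteq> loop_series N"
    and X: "\<And>w. X w \<in> loop_series N"
    and b: "\<And>w p i. p < b \<Longrightarrow> tcoeff N (X w) p i = 0"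
    and cont: "\<And>p i. continuous_on UNIV (\<lambda>w. tcoeff N (X w) p i)"
  shows "continuous_on UNIV (\<lambda>w. tcoeff N (f (X w)) p i)"
    and "continuous_on UNIV (\<lambda>w. sigma_entry N h (f (X w)) i)"
proof -
  have lim: "loop_tendsto N (\<lambda>n. f (X (x n))) (f (X a))" if "x \<longlonglongrightarrow> a" for x a
  proof -
    have conv: "(\<lambda>n. tcoeff N (X (x n)) p i) \<longlonglongrightarrow> tcoeff N (X a) p i" for p i
      by (rule continuous_on_tendsto_compose[OF cont that]) auto
    have "loop_tendsto N (\<lambda>n. X (x n)) (X a)"
      unfolding loop_tendsto_def
    proof (intro conjI exI[of _ b] allI impI)
      fix i j p assume ij: "i < N" "j < N"
      show "fls_nth (X (x n) $$ (i, j)) p = 0" if "p < b" for n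
        by (simp only: loop_series_nth[OF X ij] b[OF that] if_cancel)
      show "(\<lambda>n. fls_nth (X (x n) $$ (i, j)) p) \<longlonglongrightarrow> fls_nth (X a $$ (i, j)) p"
        unfolding loop_series_nth[OF X ij] using conv[of p "int i"] by simp
    qed
    then show ?thesis
      using f X unfolding loop_continuous_def by (simp add: image_subset_iff)
  qed
  show "continuous_on UNIV (\<lambda>w. tcoeff N (f (X w)) p i)"
  proof (rule continuous_on_sequentiallyI)
    fix x :: "nat \<Rightarrow> 'a" and a assume "x \<longlonglongrightarrow> a"
    from lim[OF this] show "(\<lambda>n. tcoeff N (f (X (x n))) p i) \<longlonglongrightarrow> tcoeff N (f (X a)) p i"
      by (simp add: loop_tendsto_def tcoeff_def)
  qed
  show "continuous_on UNIV (\<lambda>w. sigma_entry N h (f (X w)) i)"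
  proof (rule continuous_on_sequentiallyI)
    fix x :: "nat \<Rightarrow> 'a" and a assume "x \<longlonglongrightarrow> a"
    note L = lim[OF this]
    \<comment> \<open>\<open>loop_tendsto\<close> provides a degree bound uniform along the
      sequence, and the limit inherits it. Hence sigma is one fixed finite sum of convergent
      terms.\<close>
    then obtain c where c: "\<And>n p i. p < c \<Longrightarrow> tcoeff N (f (X (x n))) p i = 0"
      unfolding loop_tendsto_def tcoeff_def by (metis res_less)
    have conv: "(\<lambda>n. tcoeff N (f (X (x n))) p i) \<longlonglongrightarrow> tcoeff N (f (X a)) p i" for p i
      using L by (simp add: loop_tendsto_def tcoeff_def)
    have ca: "tcoeff N (f (X a)) p i = 0" if "p < c" for p i
      using conv[of p i] c[OF that] by (simp add: LIMSEQ_const_iff)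
    have s: "sigma_entry N h (f (X y)) i =
        (\<Sum>m<nat (- c). h ^ Suc m * tcoeff N (f (X y)) (- int (Suc m)) i)"
      if "y = a \<or> (\<exists>n. y = x n)" for y
    proof (rule sigma_entry_eq_sum)
      fix p assume "p < - int (nat (- c))"
      then have "p < c" by (simp split: if_splits)
      then show "tcoeff N (f (X y)) p i = 0" for i using that c ca by auto
    qed
    have "(\<lambda>n. \<Sum>m<nat (- c). h ^ Suc m * tcoeff N (f (X (x n))) (- int (Suc m)) i)
        \<longlonglongrightarrow> (\<Sum>m<nat (- c). h ^ Suc m * tcoeff N (f (X a)) (- int (Suc m)) i)"
      by (intro tendsto_sum tendsto_mult tendsto_const conv)
    moreover have "sigma_entry N h (f (X (x n))) i =
        (\<Sum>m<nat (- c). h ^ Suc m * tcoeff N (f (X (x n))) (- int (Suc m)) i)" for n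
      by (rule s) blast
    moreover have "sigma_entry N h (f (X a)) i =
        (\<Sum>m<nat (- c). h ^ Suc m * tcoeff N (f (X a)) (- int (Suc m)) i)"
      by (rule s) simp
    ultimately show "(\<lambda>n. sigma_entry N h (f (X (x n))) i) \<longlonglongrightarrow> sigma_entry N h (f (X a)) i"
      by (simp only:)
  qed
qed

lemma tcoeff_Lplus:
  "tcoeff N (Lplus N h u v) p i =
    tcoeff N (Fmat_inv N h) p i * u (res N (i - p)) + tcoeff N (Fmat_inv N h) (p - 1) i +
    (tcoeff N (Fmat_inv N h) (p + 1) i * u (res N (i - (p + 1))) + tcoeff N (Fmat_inv N h) p i) *
      v (res N (i - (p + 1)))"
  by (simp add: Lplus_def two_term)

lemma tcoeff_UVFinv:
  "tcoeff N (Umat N u * Vmat N v * Fmat_inv N h) p i =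
    u (res N i) * (tcoeff N (Fmat_inv N h) p i
        + v (res N i) * tcoeff N (Fmat_inv N h) (p + 1) (i + 1)) +
    (tcoeff N (Fmat_inv N h) (p - 1) (i - 1) + v (res N (i - 1)) * tcoeff N (Fmat_inv N h) p i)"
  by (simp add: loop_assoc two_term)

lemma tcoeff_VFinvU:
  "tcoeff N (Vmat N v * Fmat_inv N h * Umat N u) p i =
    (tcoeff N (Fmat_inv N h) p i + v (res N i) * tcoeff N (Fmat_inv N h) (p + 1) (i + 1))
      * u (res N (i - p)) +
    (tcoeff N (Fmat_inv N h) (p - 1) i + v (res N i) * tcoeff N (Fmat_inv N h) p (i + 1))"
  by (simp add: two_term)

lemma compatible_field_exists:
  assumes f: "conj_covariant N f" and cont: "loop_continuous N f"
  shows "compatible_field N h f (\<lambda>(u, v). (triad_A1 N h f u v, triad_A2 N h f u v))"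
proof -
  have fs: "f ` loop_series N \<subseteq> loop_series N"
    using f by (simp add: conj_covariant_def)
  \<comment> \<open>All three cyclic products start in degree -1: \<lambda>^(-1) enters only through
    V, and the inverse of F starts in degree 0.\<close>
  note comp = loop_continuous_compose[OF cont fs, where b = "- 1"]
  have c0: "continuous_on UNIV (\<lambda>w. sigma_entry N h (f (Lplus N h (fst w) (snd w))) i)" for i
    by (rule comp(2)[where X = "\<lambda>w. Lplus N h (fst w) (snd w)"])
        (auto simp: tcoeff_Lplus tcoeff_Fmat_inv intro!: continuous_intros)
  have c1: "continuous_on UNIV
      (\<lambda>w. tcoeff N (f (Umat N (fst w) * Vmat N (snd w) * Fmat_inv N h)) p i)" for p i
    by (rule comp(1)[where X = "\<lambda>w. Umat N (fst w) * Vmat N (snd w) * Fmat_inv N h"])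
        (auto simp: tcoeff_UVFinv tcoeff_Fmat_inv intro!: continuous_intros)
  have c2: "continuous_on UNIV
      (\<lambda>w. tcoeff N (f (Vmat N (snd w) * Fmat_inv N h * Umat N (fst w))) p i)" for p i
    by (rule comp(1)[where X = "\<lambda>w. Vmat N (snd w) * Fmat_inv N h * Umat N (fst w)"])
        (auto simp: tcoeff_VFinvU tcoeff_Fmat_inv intro!: continuous_intros)
  have s1: "f (Umat N u * Vmat N v * Fmat_inv N h) \<in> loop_series N" for u v
    using fs by auto
  have s2: "f (Vmat N v * Fmat_inv N h * Umat N u) \<in> loop_series N" for u v
    using fs by auto
  have "coeffs_continuous N (\<lambda>w. triad_A1 N h f (fst w) (snd w))"
  proof (rule coeffs_continuousI)
    show "triad_A1 N h f (fst w) (snd w) \<in> loop_series N" for w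
      unfolding triad_A1_def using pi_minus_diag(1)[OF s1] by simp
    show "continuous_on UNIV (\<lambda>w. tcoeff N (triad_A1 N h f (fst w) (snd w)) p i)" for p i
      unfolding triad_A1_def pi_minus_diag(2)[OF s1]
      by (intro continuous_on_If_const continuous_on_minus continuous_on_const c0 c1)
  qed
  moreover have "coeffs_continuous N (\<lambda>w. triad_A2 N h f (fst w) (snd w))"
  proof (rule coeffs_continuousI)
    show "triad_A2 N h f (fst w) (snd w) \<in> loop_series N" for w
      unfolding triad_A2_def using pi_minus_diag(1)[OF s2] by simp
    show "continuous_on UNIV (\<lambda>w. tcoeff N (triad_A2 N h f (fst w) (snd w)) p i)" for p i
      unfolding triad_A2_def pi_minus_diag(2)[OF s2]
      by (intro continuous_on_If_const continuous_on_minus continuous_on_const c0 c2)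
  qed
  moreover have "compatible N h f u v (triad_A1 N h f u v) (triad_A2 N h f u v)" for u v
    unfolding compatible_def using triad_exists[OF f] by blast
  ultimately show ?thesis
    by (simp add: compatible_field_def comp_def case_prod_beta)
qed

subsection \<open>Evolution equations\<close>

lemma has_loop_derivative_iff:
  assumes "\<And>s. X s \<in> loop_series N" "D \<in> loop_series N"
  shows "has_loop_derivative N X D t \<longleftrightarrow>
    (\<forall>p i. ((\<lambda>s. tcoeff N (X s) p i) has_real_derivative tcoeff N D p i) (at t))"
proof
  assume "has_loop_derivative N X D t"
  then show "\<forall>p i. ((\<lambda>s. tcoeff N (X s) p i) has_real_derivative tcoeff N D p i) (at t)"
    by (simp add: has_loop_derivative_def tcoeff_def)
next
  assume *: "\<forall>p i. ((\<lambda>s. tcoeff N (X s) p i) has_real_derivative tcoeff N D p i) (at t)"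
  show "has_loop_derivative N X D t"
    unfolding has_loop_derivative_def
  proof (intro allI impI)
    fix i j p assume "i < N" "j < N"
    then show "((\<lambda>s. fls_nth (X s $$ (i, j)) p) has_real_derivative fls_nth (D $$ (i, j)) p) (at t)"
      using * by (simp only: loop_series_nth assms)
        (rule has_real_derivative_If_const, simp_all)
  qed
qed

lemma Umat_derivative_iff:
  "has_loop_derivative N (\<lambda>s. Umat N (u s)) (diag_Epow N u' 0) t \<longleftrightarrow>
    (\<forall>k<N. ((\<lambda>s. u s k) has_real_derivative u' k) (at t))"
proof -
  have "(\<forall>i. ((\<lambda>s. u s (res N i)) has_real_derivative u' (res N i)) (at t)) \<longleftrightarrow>
      (\<forall>k<N. ((\<lambda>s. u s k) has_real_derivative u' k) (at t))"
    by (metis res_less res_of_nat)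
  then show ?thesis
    by (auto simp: has_loop_derivative_iff tcoeff_Umat tcoeff_diag_Epow)
qed

lemma Vmat_derivative_iff:
  "has_loop_derivative N (\<lambda>s. Vmat N (v s)) (diag_Epow N v' (- 1)) t \<longleftrightarrow>
    (\<forall>k<N. ((\<lambda>s. v s k) has_real_derivative v' k) (at t))"
proof -
  have "(\<forall>i. ((\<lambda>s. v s (res N i)) has_real_derivative v' (res N i)) (at t)) \<longleftrightarrow>
      (\<forall>k<N. ((\<lambda>s. v s k) has_real_derivative v' k) (at t))"
    by (metis res_less res_of_nat)
  then show ?thesis
    by (auto simp: has_loop_derivative_iff tcoeff_Vmat tcoeff_diag_Epow)
qed

text \<open>The triad turns the prescribed derivatives into monomials of degrees 0 and -1, where u
  and v sit; all other coefficients of U and V are constant.\<close>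

lemma lax_flow_iff:
  assumes "triad N h f (u t) (v t) A1 A2 u' v'"
  shows "lax_flow N h f u v A1 A2 t \<longleftrightarrow>
    (\<forall>k<N. ((\<lambda>s. u s k) has_real_derivative u' k) (at t) \<and>
           ((\<lambda>s. v s k) has_real_derivative v' k) (at t))"
  using assms unfolding triad_def lax_flow_def diag_Epow_0 diag_Epow_minus_1
  by (auto simp: Umat_derivative_iff Vmat_derivative_iff)

lemma A0_carrier: "A0 N h f u v \<in> carrier_mat N N"
  unfolding A0_def sigma_eq by (rule minus_carrier_mat) simp

lemma Fmat_derivative:
  assumes "A1 * Fmat N h = Fmat N h * A0 N h f u v"
  shows "has_loop_derivative N (\<lambda>s. Fmat N h) (A1 * Fmat N h - Fmat N h * A0 N h f u v) t"
proof -
  have "Fmat N h * A0 N h f u v \<in> carrier_mat N N"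
    by (rule mult_carrier_mat[OF _ A0_carrier]) simp
  then show ?thesis
    unfolding assms has_loop_derivative_def by (auto simp: carrier_matD)
qed

text \<open>The right side is the Leibniz expansion of the derivative of \<open>Lplus\<close>, with
  the inverse of F constant. Inserting the triad makes the two terms containing A2 cancel.\<close>

lemma Lplus_commutator:
  assumes tr: "triad N h f u v A1 A2 u' v'" and A0: "A0 N h f u v \<in> loop_series N"
  shows "A0 N h f u v * Lplus N h u v - Lplus N h u v * A0 N h f u v =
    Fmat_inv N h * diag_Epow N u' 0 * Vmat N v + Fmat_inv N h * Umat N u * diag_Epow N v' (- 1)"
proof -
  let ?U = "Umat N u" and ?V = "Vmat N v" and ?F = "Fmat N h" and ?G = "Fmat_inv N h"
    and ?A0 = "A0 N h f u v"
  have A: "A1 \<in> loop_series N" "A2 \<in> loop_series N"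
    and eF: "A1 * ?F = ?F * ?A0"
    and eU: "diag_Epow N u' 0 = A1 * ?U - ?U * A2"
    and eV: "diag_Epow N v' (- 1) = A2 * ?V - ?V * ?A0"
    using tr unfolding triad_def diag_Epow_0 diag_Epow_minus_1 by simp_all
  have GF: "?G * ?F = 1\<^sub>m N" and FG: "?F * ?G = 1\<^sub>m N"
    using Fmat_inv_mult[OF N_pos] Fmat_mult_inv by auto
  have "?G * (A1 * ?F) * ?G = ?G * (?F * ?A0) * ?G" by (simp only: eF)
  moreover have "?G * (A1 * ?F) * ?G = ?G * A1 * (?F * ?G)"
    "?G * (?F * ?A0) * ?G = ?G * ?F * (?A0 * ?G)"
    using A A0 by (simp_all add: loop_assoc)
  \<comment> \<open>The identity for F, multiplied by its inverse on both sides, moves A1 through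
    that inverse as A0.\<close>
  ultimately have GA: "?G * A1 = ?A0 * ?G"
    using A A0 by (simp add: GF FG)
  have 1: "?G * diag_Epow N u' 0 * ?V = ?G * A1 * (?U * ?V) - ?G * (?U * (A2 * ?V))"
    using A unfolding eU
    by (simp add: mult_minus_distrib_mat[of _ N N _ N] minus_mult_distrib_mat[of _ N N _ _ N] loop_assoc)
  have 2: "?G * ?U * diag_Epow N v' (- 1) = ?G * (?U * (A2 * ?V)) - ?G * (?U * (?V * ?A0))"
    using A A0 unfolding eV
    by (simp add: mult_minus_distrib_mat[of _ N N _ N] loop_assoc)
  have 3: "?A0 * Lplus N h u v = ?G * A1 * (?U * ?V)"
    using A A0 unfolding GA by (simp add: Lplus_def loop_assoc)
  have 4: "Lplus N h u v * ?A0 = ?G * (?U * (?V * ?A0))"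
    using A A0 by (simp add: Lplus_def loop_assoc)
  show ?thesis
    unfolding 1 2 3 4 by (rule loop_series_eqI) (use A A0 in simp_all)
qed

text \<open>Each coefficient of \<open>Lplus\<close> is a polynomial in u and v, so the product rule
  applies degree by degree and matches the commutator formula.\<close>

lemma Lplus_derivative:
  assumes f: "f (Lplus N h (u t) (v t)) \<in> loop_series N"
    and c: "compatible N h f (u t) (v t) A1 A2" and lax: "lax_flow N h f u v A1 A2 t"
  shows "has_loop_derivative N (\<lambda>s. Lplus N h (u s) (v s))
    (A0 N h f (u t) (v t) * Lplus N h (u t) (v t) - Lplus N h (u t) (v t) * A0 N h f (u t) (v t)) t"
proof -
  obtain u' v' where tr: "triad N h f (u t) (v t) A1 A2 u' v'"
    using c by (auto simp: compatible_def)
  have d: "((\<lambda>s. u s (res N i)) has_real_derivative u' (res N i)) (at t)"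
    "((\<lambda>s. v s (res N i)) has_real_derivative v' (res N i)) (at t)" for i
    using lax lax_flow_iff[where u = u and v = v and t = t, OF tr] by auto
  have "A0 N h f (u t) (v t) \<in> loop_series N"
    unfolding A0_eq using pi_minus_diag(1)[OF f] by simp
  note comm = Lplus_commutator[OF tr this]
  show ?thesis
    unfolding comm
    by (subst has_loop_derivative_iff)
       (auto simp: tcoeff_Lplus two_term tcoeff_mult_diag_Epow algebra_simps
          intro!: derivative_eq_intros d)
qed

subsection \<open>The first flow\<close>

lemma first_A0_eq: "first_A0 N h u v = diag_Epow N (\<lambda>k. u k * v k) (- 1) - diag_Epow N (\<lambda>k. h * (u k * v k)) 0"
  unfolding first_A0_def diag_Epow_0 diag_Epow_minus_1 smult_diag_Epow ..

lemma first_A1_eq: "first_A1 N h u v = diag_Epow N (\<lambda>k. u k * v k) (- 1)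
    - diag_Epow N (\<lambda>k. h * (u ((k + N - 1) mod N) * v ((k + N - 1) mod N))) 0"
  unfolding first_A1_def diag_Epow_0 diag_Epow_minus_1 smult_diag_Epow ..

lemma first_A2_eq: "first_A2 N h u v = diag_Epow N (\<lambda>k. u ((k + 1) mod N) * v k) (- 1)
    - diag_Epow N (\<lambda>k. h * (u k * v k)) 0"
  unfolding first_A2_def diag_Epow_0 diag_Epow_minus_1 smult_diag_Epow ..

lemma res_pred: "(res N i + N - 1) mod N = res N (i - 1)"
proof -
  \<comment> \<open>Adding N before subtracting keeps natural subtraction exact at residue
    0.\<close>
  have "int (res N i + N - 1) = i mod int N - 1 + int N"
    using N_pos by (simp add: of_nat_diff)
  then have "int ((res N i + N - 1) mod N) = int (res N (i - 1))"
    by (simp only: zmod_int mod_add_self2 mod_diff_left_eq int_res)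
  then show ?thesis by (simp only: of_nat_eq_iff)
qed

lemma res_succ: "(res N i + 1) mod N = res N (i + 1)"
proof -
  have "int (res N i + 1) = i mod int N + 1" by simp
  then have "int ((res N i + 1) mod N) = int (res N (i + 1))"
    by (simp only: zmod_int mod_add_left_eq int_res)
  then show ?thesis by (simp only: of_nat_eq_iff)
qed

lemma tcoeff_first:
  "tcoeff N (first_A0 N h u v) p i =
    (if p = - 1 then u (res N i) * v (res N i) else if p = 0 then - h * u (res N i) * v (res N i) else 0)"
  "tcoeff N (first_A1 N h u v) p i =
    (if p = - 1 then u (res N i) * v (res N i)
     else if p = 0 then - h * u (res N (i - 1)) * v (res N (i - 1)) else 0)"
  "tcoeff N (first_A2 N h u v) p i =
    (if p = - 1 then u (res N (i + 1)) * v (res N i)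
     else if p = 0 then - h * u (res N i) * v (res N i) else 0)"
  by (simp_all add: first_A0_eq first_A1_eq first_A2_eq tcoeff_diag_Epow
      res_pred[simplified] res_succ[simplified])

lemma first_series [simp]:
  "first_A0 N h u v \<in> loop_series N" "first_A1 N h u v \<in> loop_series N"
  "first_A2 N h u v \<in> loop_series N"
  by (simp_all add: first_A0_eq first_A1_eq first_A2_eq)

lemma first_algebra: "first_A1 N h u v \<in> loop_algebra N" "first_A2 N h u v \<in> loop_algebra N"
  unfolding loop_algebra_iff by (auto simp: tcoeff_first intro!: exI[of _ 0])

lemma A0_id: "A0 N h (\<lambda>L. L) u v = first_A0 N h u v"
proof (rule loop_series_eqI)
  \<comment> \<open>The only negative degree of \<open>Lplus\<close> is -1, with coefficient u v, so
    sigma has a single term.\<close>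
  have "sigma_entry N h (Lplus N h u v) i = h * (u (res N i) * v (res N i))" for i
    by (subst sigma_entry_eq_sum[of 1])
       (auto simp: tcoeff_Lplus tcoeff_Fmat_inv)
  then show "tcoeff N (A0 N h (\<lambda>L. L) u v) p i = tcoeff N (first_A0 N h u v) p i" for p i
    unfolding A0_eq pi_minus_diag(2)[OF Lplus_series] tcoeff_first
    by (auto simp: tcoeff_Lplus tcoeff_Fmat_inv)
  show "A0 N h (\<lambda>L. L) u v \<in> loop_series N"
    unfolding A0_eq using pi_minus_diag(1)[OF Lplus_series] by simp
qed simp

lemma first_triad:
  "triad N h (\<lambda>L. L) u v (first_A1 N h u v) (first_A2 N h u v)
     (first_udot N h u v) (first_vdot N h u v)"
proof -
  have ud: "first_udot N h u v (res N i) = u (res N i) * (v (res N i) - v (res N (i - 1))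
      + h * u (res N i) * v (res N i) - h * u (res N (i - 1)) * v (res N (i - 1)))" for i
    by (simp add: first_udot_def Let_def res_pred[simplified])
  have vd: "first_vdot N h u v (res N i) = v (res N i) * (u (res N (i + 1)) - u (res N i)
      + h * u (res N (i + 1)) * v (res N (i + 1)) - h * u (res N i) * v (res N i))" for i
    by (simp add: first_vdot_def Let_def res_succ[simplified])
  have "first_A1 N h u v * Fmat N h = Fmat N h * first_A0 N h u v"
    by (rule loop_series_eqI) (auto simp: two_term tcoeff_first)
  moreover have "first_A1 N h u v * Umat N u - Umat N u * first_A2 N h u v =
      diag_Epow N (first_udot N h u v) 0"
    by (rule loop_series_eqI)
       (auto simp: two_term tcoeff_first tcoeff_diag_Epow ud algebra_simps)
  moreover have "first_A2 N h u v * Vmat N v - Vmat N v * first_A0 N h u v =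
      diag_Epow N (first_vdot N h u v) (- 1)"
  proof (rule loop_series_eqI)
    show "tcoeff N (first_A2 N h u v * Vmat N v - Vmat N v * first_A0 N h u v) p i =
        tcoeff N (diag_Epow N (first_vdot N h u v) (- 1)) p i" for p i
      \<comment> \<open>In degree -2 both products contribute u(i + 1) v(i) v(i + 1), the lowest
        terms, which cancel.\<close>
      by (cases "p = - 2")
         (auto simp: two_term tcoeff_first tcoeff_diag_Epow vd algebra_simps)
  qed simp_all
  ultimately show ?thesis
    unfolding triad_def diag_Epow_0 diag_Epow_minus_1 A0_id using first_algebra by blast
qed

lemma first_compatible_field:
  "compatible_field N h (\<lambda>L. L) (\<lambda>(u, v). (first_A1 N h u v, first_A2 N h u v))"
proof -
  have "coeffs_continuous N (\<lambda>w. first_A1 N h (fst w) (snd w))"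
    "coeffs_continuous N (\<lambda>w. first_A2 N h (fst w) (snd w))"
    by (rule coeffs_continuousI; auto simp: tcoeff_first intro!: continuous_intros)+
  moreover have "compatible N h (\<lambda>L. L) u v (first_A1 N h u v) (first_A2 N h u v)" for u v
    unfolding compatible_def using first_triad by blast
  ultimately show ?thesis
    by (simp add: compatible_field_def comp_def case_prod_beta)
qed

text \<open>Uniqueness of continuous fields identifies any solution with the explicit one.\<close>

lemma compatible_field_id_iff:
  "compatible_field N h (\<lambda>L. L) A \<longleftrightarrow> A = (\<lambda>(u, v). (first_A1 N h u v, first_A2 N h u v))"
  using first_compatible_field compatible_field_unique by blast

end

text \<open>Uniqueness appears pointwise for A1, pointwise for A2 where u or v has no zero
  component, and globally for continuous fields. Continuity of f enters for the existence of such a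
  field.\<close>

theorem theorem4p9:
  fixes N :: nat and h :: real and f :: "real fls mat \<Rightarrow> real fls mat"
  assumes "N > 0" and "conj_covariant N f"
  shows
    "(\<forall>u v. \<exists>A1 A2. compatible N h f u v A1 A2) \<and>
     (\<forall>u v A1 A2 B1 B2. compatible N h f u v A1 A2 \<and> compatible N h f u v B1 B2 \<longrightarrow>
        A1 = B1 \<and> ((\<forall>k<N. u k \<noteq> 0) \<or> (\<forall>k<N. v k \<noteq> 0) \<longrightarrow> A2 = B2)) \<and>
     (\<forall>A B. compatible_field N h f A \<and> compatible_field N h f B \<longrightarrow> A = B) \<and>
     (loop_continuous N f \<longrightarrow> (\<exists>!A. compatible_field N h f A)) \<and>
     (\<forall>(u :: real \<Rightarrow> nat \<Rightarrow> real) v A1 A2 u' v' t. triad N h f (u t) (v t) A1 A2 u' v' \<longrightarrow>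
        (lax_flow N h f u v A1 A2 t \<longleftrightarrow>
          (\<forall>k<N. ((\<lambda>s. u s k) has_real_derivative u' k) (at t) \<and>
                 ((\<lambda>s. v s k) has_real_derivative v' k) (at t)))) \<and>
     (\<forall>(u :: real \<Rightarrow> nat \<Rightarrow> real) v A1 A2 t.
        compatible N h f (u t) (v t) A1 A2 \<and> lax_flow N h f u v A1 A2 t \<longrightarrow>
        has_loop_derivative N (\<lambda>s. Fmat N h)
          (A1 * Fmat N h - Fmat N h * A0 N h f (u t) (v t)) t \<and>
        has_loop_derivative N (\<lambda>s. Lplus N h (u s) (v s))
          (A0 N h f (u t) (v t) * Lplus N h (u t) (v t)
            - Lplus N h (u t) (v t) * A0 N h f (u t) (v t)) t) \<and>
     (\<forall>u v. A0 N h (\<lambda>L. L) u v = first_A0 N h u v) \<and>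
     (\<forall>u v. triad N h (\<lambda>L. L) u v (first_A1 N h u v) (first_A2 N h u v)
        (first_udot N h u v) (first_vdot N h u v)) \<and>
     (\<forall>A. compatible_field N h (\<lambda>L. L) A \<longleftrightarrow>
        A = (\<lambda>(u, v). (first_A1 N h u v, first_A2 N h u v))) \<and>
     (\<forall>A (u :: real \<Rightarrow> nat \<Rightarrow> real) v t. compatible_field N h (\<lambda>L. L) A \<longrightarrow>
        (lax_flow N h (\<lambda>L. L) u v (fst (A (u t, v t))) (snd (A (u t, v t))) t \<longleftrightarrow>
          (\<forall>k<N. ((\<lambda>s. u s k) has_real_derivative first_udot N h (u t) (v t) k) (at t) \<and>
                 ((\<lambda>s. v s k) has_real_derivative first_vdot N h (u t) (v t) k) (at t))))"
proof (intro conjI allI impI; (elim conjE)?)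
  show "\<exists>A1 A2. compatible N h f u v A1 A2" for u v
    unfolding compatible_def using triad_exists[OF assms] by blast
  show "A1 = B1" if "compatible N h f u v A1 A2" "compatible N h f u v B1 B2" for u v A1 A2 B1 B2
    by (rule compatible_A1_unique[OF assms(1) that])
  show "A2 = B2" if "compatible N h f u v A1 A2" "compatible N h f u v B1 B2"
    "(\<forall>k<N. u k \<noteq> 0) \<or> (\<forall>k<N. v k \<noteq> 0)" for u v A1 A2 B1 B2
    by (rule compatible_A2_unique[OF assms(1) that])
  show "A = B" if "compatible_field N h f A" "compatible_field N h f B" for A B
    by (rule compatible_field_unique[OF assms(1) that])
  show "\<exists>!A. compatible_field N h f A" if "loop_continuous N f"
    using compatible_field_exists[OF assms that] compatible_field_unique[OF assms(1)] by blast
  show "lax_flow N h f u v A1 A2 t \<longleftrightarrow>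
      (\<forall>k<N. ((\<lambda>s. u s k) has_real_derivative u' k) (at t) \<and>
             ((\<lambda>s. v s k) has_real_derivative v' k) (at t))"
    if "triad N h f (u t) (v t) A1 A2 u' v'" for u v A1 A2 u' v' t
    by (rule lax_flow_iff[OF assms(1), where u = u and v = v and t = t, OF that])
  show "has_loop_derivative N (\<lambda>s. Fmat N h) (A1 * Fmat N h - Fmat N h * A0 N h f (u t) (v t)) t"
    if "compatible N h f (u t) (v t) A1 A2" for u v A1 A2 t
    by (rule Fmat_derivative[OF assms(1)]) (use that in \<open>auto simp: compatible_def triad_def\<close>)
  show "has_loop_derivative N (\<lambda>s. Lplus N h (u s) (v s))
      (A0 N h f (u t) (v t) * Lplus N h (u t) (v t)
        - Lplus N h (u t) (v t) * A0 N h f (u t) (v t)) t"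
    if "compatible N h f (u t) (v t) A1 A2" "lax_flow N h f u v A1 A2 t" for u v A1 A2 t
    using assms(2) Lplus_series[OF assms(1)]
    by (intro Lplus_derivative[OF assms(1) _ that]) (auto simp: conj_covariant_def)
  show "A0 N h (\<lambda>L. L) u v = first_A0 N h u v" for u v
    by (rule A0_id[OF assms(1)])
  show "triad N h (\<lambda>L. L) u v (first_A1 N h u v) (first_A2 N h u v)
      (first_udot N h u v) (first_vdot N h u v)" for u v
    by (rule first_triad[OF assms(1)])
  show "compatible_field N h (\<lambda>L. L) A \<longleftrightarrow> A = (\<lambda>(u, v). (first_A1 N h u v, first_A2 N h u v))" for A
    by (rule compatible_field_id_iff[OF assms(1)])
  show "lax_flow N h (\<lambda>L. L) u v (fst (A (u t, v t))) (snd (A (u t, v t))) t \<longleftrightarrow>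
      (\<forall>k<N. ((\<lambda>s. u s k) has_real_derivative first_udot N h (u t) (v t) k) (at t) \<and>
             ((\<lambda>s. v s k) has_real_derivative first_vdot N h (u t) (v t) k) (at t))"
    if "compatible_field N h (\<lambda>L. L) A" for A u v t
    using that lax_flow_iff[OF assms(1), where u = u and v = v and t = t, OF first_triad[OF assms(1)], of h]
    by (simp add: compatible_field_id_iff[OF assms(1)])
qed

end
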